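(* Let $G$ be a connected graph with distance matrix $D(G)$ whose second largest eigenvalue satisfies $\lambda_{2}(D(G))\leq\frac{17-\sqrt{329}}{2}\approx-0.5692$. Then $G$ is determined by its $D$-spectrum: every connected graph $H$ whose distance matrix $D(H)$ has the same spectrum (eigenvalues with multiplicities) as $D(G)$ is isomorphic to $G$.
   Context: All graphs are simple, undirected and connected. The distance matrix $D(G)=(d_{ij})$ of a connected graph $G$ on vertices $v_1,\dots,v_n$ has $d_{ij}$ equal to the distance between $v_i$ and $v_j$. Its eigenvalues are ordered $\lambda_{1}(D(G))\geq\lambda_{2}(D(G))\geq\cdots\geq\lambda_{n}(D(G))$ (the $D$-spectrum). *)

theory Defs
  imports "Jordan_Normal_Form.Char_Poly" "HOL-Library.Multiset"
begin

definition simple_graph :: "nat \<Rightarrow> (nat \<Rightarrow> nat \<Rightarrow> bool) \<Rightarrow> bool" where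
  "simple_graph n E \<longleftrightarrow>
     (\<forall>u v. E u v \<longrightarrow> u < n \<and> v < n) \<and>
     (\<forall>u v. E u v \<longrightarrow> E v u) \<and>
     (\<forall>u. \<not> E u u)"

definition walk :: "nat \<Rightarrow> (nat \<Rightarrow> nat \<Rightarrow> bool) \<Rightarrow> nat list \<Rightarrow> bool" where
  "walk n E xs \<longleftrightarrow> xs \<noteq> [] \<and> set xs \<subseteq> {..<n} \<and>
     (\<forall>i. Suc i < length xs \<longrightarrow> E (xs ! i) (xs ! Suc i))"

definition connected_graph :: "nat \<Rightarrow> (nat \<Rightarrow> nat \<Rightarrow> bool) \<Rightarrow> bool" where
  "connected_graph n E \<longleftrightarrow> simple_graph n E \<and> 0 < n \<and>
     (\<forall>u<n. \<forall>v<n. \<exists>xs. walk n E xs \<and> hd xs = u \<and> last xs = v)"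

definition gdist :: "nat \<Rightarrow> (nat \<Rightarrow> nat \<Rightarrow> bool) \<Rightarrow> nat \<Rightarrow> nat \<Rightarrow> nat" where
  "gdist n E u v = (LEAST k. \<exists>xs. walk n E xs \<and> hd xs = u \<and> last xs = v \<and> length xs = Suc k)"

definition dist_matrix :: "nat \<Rightarrow> (nat \<Rightarrow> nat \<Rightarrow> bool) \<Rightarrow> real mat" where
  "dist_matrix n E = mat n n (\<lambda>(i, j). real (gdist n E i j))"

text \<open>D-spectrum: multiset of eigenvalues (roots of the characteristic polynomial, with
  multiplicity). The distance matrix is real symmetric, so all eigenvalues are real.\<close>
definition D_spectrum :: "nat \<Rightarrow> (nat \<Rightarrow> nat \<Rightarrow> bool) \<Rightarrow> real multiset" where
  "D_spectrum n E = proots (char_poly (dist_matrix n E))"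

text \<open>k-th largest eigenvalue (k \<ge> 1), eigenvalues in non-increasing order.\<close>
definition D_eig :: "nat \<Rightarrow> (nat \<Rightarrow> nat \<Rightarrow> bool) \<Rightarrow> nat \<Rightarrow> real" where
  "D_eig n E k = rev (sorted_list_of_multiset (D_spectrum n E)) ! (k - 1)"

definition graph_iso :: "nat \<Rightarrow> (nat \<Rightarrow> nat \<Rightarrow> bool) \<Rightarrow> nat \<Rightarrow> (nat \<Rightarrow> nat \<Rightarrow> bool) \<Rightarrow> bool" where
  "graph_iso n E m F \<longleftrightarrow> (\<exists>f. bij_betw f {..<n} {..<m} \<and>
     (\<forall>u<n. \<forall>v<n. E u v \<longleftrightarrow> F (f u) (f v)))"

end

theory Submission
  imports Defs
begin

text \<open>
  If an isometric subgraph of \<open>G\<close> is given, its distance matrix is a principal submatrix of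
  \<open>D(G)\<close>, so its second largest eigenvalue is at most that of \<open>G\<close>. Testing small graphs this way
  excludes induced 4-cycles, diamonds, 5-cycles and every way of joining a further vertex to an
  isometric path \<open>P4\<close> except the bull. Hence \<open>G\<close> is complete, or a windmill (a hub joined to disjoint
  cliques), or a clique some of whose vertices carry one pendant vertex each.

  The sum of the squared distances is the sum of the squared eigenvalues; it recognises complete
  graphs and, for a given order, the number of pendant vertices. For a windmill with \<open>k\<close> blades of
  sizes \<open>n_i\<close>, the characteristic polynomial is \<open>(x + 1)^(n - 1 - k) Q\<close> with \<open>Q(-1) \<noteq> 0\<close>, where
  \<open>Q = x P - (1 + 2x) (k P - (x + 1) P')\<close> and \<open>P\<close> is the product of the \<open>x + 1 + n_i\<close>;
  so \<open>k\<close>, \<open>Q\<close>, and then \<open>P\<close>, are determined by the spectrum. Finally, graphs with at least two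
  pendant vertices have the eigenvalues \<open>-2 \<plusminus> sqrt 2\<close>; a windmill has them only for the sizes
  2, 2, 3, 3, and then its sum of squared distances is not that of a clique with pendant vertices.
\<close>

section \<open>The spectral theorem for real symmetric matrices\<close>

text \<open>The bound on the second eigenvalue is itself a property of the spectrum, so a cospectral
  mate obeys it too, and the claim reduces to comparing members of three explicit families. Small
  graphs are excluded by test planes: if \<open>D + 0.569 I\<close> were positive definite on a
  plane, two eigenvalues would exceed -0.569. What can be tested is a metric, and an induced
  subgraph need not be isometric; distances are therefore settled before each exclusion, and an
  induced \<open>P4\<close> is isometric only because 4-cycles, diamonds and 5-cycles are already
  gone. Squared distances cannot separate windmills, since for given order they fix only the sum of
  the squared blade sizes; this is why the whole characteristic polynomial is computed. In the mixed
  case the eigenvalues -2 + sqrt 2 and -2 - sqrt 2 are conjugate, so that they yield two rational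
  equations for the sizes. The spectrum is a multiset of real roots, and the spectral theorem
  guarantees that no root is missing from it: only then does it give back the order and the
  characteristic polynomial.\<close>

lemma symmetric_real_eigenvalue_exists:
  fixes A :: "real mat"
  assumes A: "A \<in> carrier_mat n n" and sym: "transpose_mat A = A" and n: "0 < n"
  shows "\<exists>e. eigenvalue A e"
proof -
  let ?C = "map_mat complex_of_real A"
  have C: "?C \<in> carrier_mat n n" using A by simp
  obtain as where as: "char_poly ?C = (\<Prod>a\<leftarrow>as. [:- a, 1:])" "length as = n"
    using char_poly_factorized[OF C] by blast
  obtain a as' where "as = a # as'" using as(2) n by (cases as) auto
  then have root: "poly (char_poly ?C) a = 0" using as(1) by simp
  then have "eigenvalue ?C a" using eigenvalue_root_char_poly[OF C] by simp
  then obtain v where v: "v \<in> carrier_vec n" "v \<noteq> 0\<^sub>v n" "?C *\<^sub>v v = a \<cdot>\<^sub>v v"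
    unfolding eigenvalue_def eigenvector_def using C by auto
  have row: "(\<Sum>j<n. complex_of_real (A $$ (i,j)) * v $ j) = a * v $ i" if i: "i < n" for i
  proof -
    have "(?C *\<^sub>v v) $ i = a * v $ i" using v i by simp
    moreover have "(?C *\<^sub>v v) $ i = (\<Sum>j<n. complex_of_real (A $$ (i,j)) * v $ j)"
      using A v(1) i by (simp add: scalar_prod_def lessThan_atLeast0)
    ultimately show ?thesis by simp
  qed
  \<comment> \<open>The Hermitian form of \<open>v\<close>: the eigenvalue equation gives
    \<open>a\<close> times the squared norm of \<open>v\<close>, the symmetry of \<open>A\<close>
    makes it real, hence \<open>a\<close> is real.\<close>
  define s where "s = (\<Sum>i<n. \<Sum>j<n. cnj (v $ i) * complex_of_real (A $$ (i,j)) * v $ j)"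
  define r where "r = (\<Sum>i<n. (cmod (v $ i))\<^sup>2)"
  have s1: "s = a * of_real r"
  proof -
    have "s = (\<Sum>i<n. cnj (v $ i) * (a * v $ i))"
      unfolding s_def using row by (intro sum.cong) (auto simp: sum_distrib_left mult.assoc simp flip: row)
    also have "\<dots> = (\<Sum>i<n. a * of_real ((cmod (v $ i))\<^sup>2))"
      by (intro sum.cong) (auto simp: complex_norm_square[symmetric] algebra_simps)
    also have "\<dots> = a * of_real r" unfolding r_def by (simp add: sum_distrib_left)
    finally show ?thesis .
  qed
  have symA: "A $$ (i,j) = A $$ (j,i)" if "i < n" "j < n" for i j
    using arg_cong[OF sym, of "\<lambda>M. M $$ (j,i)"] that A by auto
  have "cnj s = s"
  proof -
    have "cnj s = (\<Sum>i<n. \<Sum>j<n. v $ i * complex_of_real (A $$ (i,j)) * cnj (v $ j))"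
      unfolding s_def by simp
    also have "\<dots> = (\<Sum>j<n. \<Sum>i<n. v $ i * complex_of_real (A $$ (i,j)) * cnj (v $ j))"
      by (rule sum.swap)
    also have "\<dots> = s" unfolding s_def
      by (intro sum.cong refl) (auto simp: symA algebra_simps)
    finally show ?thesis .
  qed
  moreover have "r > 0"
  proof -
    obtain i where i: "i < n" "v $ i \<noteq> 0" using v(1,2) by (metis eq_vecI carrier_vecD index_zero_vec)
    have "(cmod (v $ i))\<^sup>2 \<le> r" unfolding r_def
      by (rule member_le_sum) (use i in auto)
    moreover have "(cmod (v $ i))\<^sup>2 > 0" using i by simp
    ultimately show ?thesis by linarith
  qed
  ultimately have "cnj a = a" using s1 by simp
  then have a: "a = complex_of_real (Re a)" by (simp add: complex_eq_iff)
  have "char_poly ?C = map_poly complex_of_real (char_poly A)"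
    using of_real_hom.char_poly_hom[OF A] .
  then have "poly (map_poly complex_of_real (char_poly A)) (complex_of_real (Re a)) = 0"
    using root a by simp
  then have "complex_of_real (poly (char_poly A) (Re a)) = 0"
    by (simp add: of_real_hom.poly_map_poly)
  then have "poly (char_poly A) (Re a) = 0" by simp
  then show ?thesis using eigenvalue_root_char_poly[OF A] by blast
qed

text \<open>With u = e_0 - v and v of length 1 one has |u|^2 = 2 u_0, so the Householder reflection
  I - 2 u u^T / |u|^2 becomes I - u u^T / u_0. It exchanges e_0 and v. For v = e_0 the vector u
  vanishes and the identity serves.\<close>

lemma householder_reflection_exists:
  fixes v :: "real vec"
  assumes v: "v \<in> carrier_vec n" and unit: "v \<bullet> v = 1" and n: "0 < n"
  shows "\<exists>H \<in> carrier_mat n n. H * H = 1\<^sub>m n \<and> transpose_mat H = H \<and> col H 0 = v"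
proof (cases "v = unit_vec n 0")
  case True
  then show ?thesis using n by (intro bexI[of _ "1\<^sub>m n"]) auto
next
  case False
  define u where "u i = (if i = 0 then 1 else 0) - v $ i" for i
  have vv: "(\<Sum>i<n. v $ i * v $ i) = 1"
    using unit v by (simp add: scalar_prod_def lessThan_atLeast0)
  have uu: "(\<Sum>i<n. u i * u i) = 2 * u 0"
  proof -
    have "(\<Sum>i<n. u i * u i) = (\<Sum>i<n. (if i = 0 then 1 - 2 * v $ i else 0) + v $ i * v $ i)"
      by (intro sum.cong) (auto simp: u_def algebra_simps)
    also have "\<dots> = 1 - 2 * v $ 0 + 1" using n by (simp add: sum.distrib vv)
    finally show ?thesis by (simp add: u_def)
  qed
  have u0: "u 0 \<noteq> 0"
  proof
    assume "u 0 = 0"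
    then have s: "(\<Sum>i<n. u i * u i) = 0" using uu by simp
    then have "\<forall>i\<in>{..<n}. u i * u i = 0" by (subst (asm) sum_nonneg_eq_0_iff) auto
    then have "v = unit_vec n 0" using v n by (intro eq_vecI) (auto simp: u_def unit_vec_def)
    then show False using False by simp
  qed
  define H where "H = mat n n (\<lambda>(i,j). (if i = j then 1 else 0) - u i * u j / u 0)"
  have H: "H \<in> carrier_mat n n" unfolding H_def by simp
  have "(H * H) $$ (i,j) = 1\<^sub>m n $$ (i,j)" if ij: "i < n" "j < n" for i j
  proof -
    have "(H * H) $$ (i,j) = (\<Sum>k<n. ((if i = k then 1 else 0) - u i * u k / u 0) * ((if k = j then 1 else 0) - u k * u j / u 0))"
      using ij by (simp add: H_def scalar_prod_def lessThan_atLeast0)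
    also have "\<dots> = (\<Sum>k<n. (if k = i then (if i = j then 1 else 0) - u i * u j / u 0 else 0)
        - (if k = j then u i * u j / u 0 else 0) + u i * u j / (u 0 * u 0) * (u k * u k))"
      by (intro sum.cong) (auto simp: field_simps u0)
    also have "\<dots> = (if i = j then 1 else 0) - u i * u j / u 0 - u i * u j / u 0
       + u i * u j / (u 0 * u 0) * (2 * u 0)"
      using ij by (simp add: sum.distrib sum_subtractf uu flip: sum_distrib_left sum_divide_distrib)
    also have "\<dots> = (if i = j then 1 else 0)" using u0 by (simp add: field_simps)
    finally show ?thesis using ij by simp
  qed
  then have "H * H = 1\<^sub>m n" using H by (intro eq_matI) auto
  moreover have "transpose_mat H = H" by (intro eq_matI) (auto simp: H_def)
  moreover have "col H 0 = v"
    using v n u0 by (intro eq_vecI) (auto simp: H_def u_def)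
  ultimately show ?thesis using H by blast
qed

definition diag_of_list :: "real list \<Rightarrow> real mat" where
  "diag_of_list es = mat (length es) (length es) (\<lambda>(i,j). if i = j then es ! i else 0)"

lemma diag_of_list_Cons:
  "diag_of_list (e # es) =
    four_block_mat (mat 1 1 (\<lambda>_. e)) (0\<^sub>m 1 (length es)) (0\<^sub>m (length es) 1) (diag_of_list es)"
proof (rule eq_matI, goal_cases)
  case (1 i j)
  then show ?case by (cases i; cases j) (auto simp: diag_of_list_def)
qed (auto simp: diag_of_list_def)

text \<open>Deflation: conjugation by a reflection \<open>H\<close> whose first column is a unit
  eigenvector puts the eigenvalue into the corner and clears the first column, and by symmetry the
  first row. The remaining block \<open>C\<close> is symmetric again. As \<open>H\<close> is its own
  inverse and transpose, similarity and orthogonality are preserved together.\<close>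

theorem real_symmetric_spectral:
  fixes A :: "real mat"
  assumes "A \<in> carrier_mat n n" and "transpose_mat A = A"
  shows "\<exists>es P. length es = n \<and> P \<in> carrier_mat n n \<and> transpose_mat P * P = 1\<^sub>m n \<and>
      A = P * diag_of_list es * transpose_mat P \<and> char_poly A = (\<Prod>e\<leftarrow>es. [:- e, 1:])"
  using assms
proof (induction n arbitrary: A)
  case 0
  then have "char_poly A = 1"
    using degree_monic_char_poly[of A 0] by (metis monic_degree_0)
  moreover have "A = 1\<^sub>m 0 * diag_of_list [] * transpose_mat (1\<^sub>m 0)"
    using 0 by (intro eq_matI) auto
  ultimately show ?case by (intro exI[of _ "[]"] exI[of _ "1\<^sub>m 0"]) auto
next
  case (Suc n)
  let ?N = "Suc n"
  note A = Suc.prems(1) and sym = Suc.prems(2)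
  obtain e v0 where ev: "v0 \<in> carrier_vec ?N" "v0 \<noteq> 0\<^sub>v ?N" "A *\<^sub>v v0 = e \<cdot>\<^sub>v v0"
    using symmetric_real_eigenvalue_exists[OF A sym] A unfolding eigenvalue_def eigenvector_def by auto
  have pos: "v0 \<bullet> v0 > 0"
  proof -
    have "v0 \<bullet> v0 \<ge> 0" unfolding scalar_prod_def by (auto intro: sum_nonneg)
    moreover have "v0 \<bullet> v0 \<noteq> 0"
      using ev(1,2) conjugate_square_eq_0_vec[of v0 ?N] by (simp add: conjugate_vec_def)
    ultimately show ?thesis by linarith
  qed
  define v where "v = (1 / sqrt (v0 \<bullet> v0)) \<cdot>\<^sub>v v0"
  have v: "v \<in> carrier_vec ?N" unfolding v_def using ev by simp
  have vv: "v \<bullet> v = 1" using ev(1) pos by (simp add: v_def)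
  have Av: "A *\<^sub>v v = e \<cdot>\<^sub>v v" unfolding v_def
    using ev A by (simp add: mult_mat_vec smult_smult_assoc mult.commute)
  obtain H where H: "H \<in> carrier_mat ?N ?N" "H * H = 1\<^sub>m ?N" "transpose_mat H = H" "col H 0 = v"
    using householder_reflection_exists[OF v vv] by auto
  define B where "B = H * A * H"
  have B: "B \<in> carrier_mat ?N ?N" unfolding B_def using H A by simp
  have AB: "A = H * B * H"
  proof -
    have "H * B * H = (H * H) * A * (H * H)" unfolding B_def using H(1) A
      by (simp add: assoc_mult_mat[where n\<^sub>1="?N" and n\<^sub>2="?N" and n\<^sub>3="?N" and n\<^sub>4="?N"])
    then show ?thesis using H(2) A by simp
  qed
  have Bsym: "transpose_mat B = B" unfolding B_def using H A sym
    by (simp add: transpose_mult[where nr="?N" and n="?N" and nc="?N"] assoc_mult_mat[where n\<^sub>1="?N" and n\<^sub>2="?N" and n\<^sub>3="?N" and n\<^sub>4="?N"])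
  have Hv: "H *\<^sub>v v = unit_vec ?N 0"
  proof -
    have "H *\<^sub>v v = col (H * H) 0" using H(1,4) by (subst col_mult2[of _ ?N ?N _ ?N]) auto
    then show ?thesis using H(2) by simp
  qed
  have colB: "col B 0 = e \<cdot>\<^sub>v unit_vec ?N 0"
  proof -
    have "col B 0 = (H * A) *\<^sub>v v" unfolding B_def using H A by (subst col_mult2[of _ ?N ?N _ ?N]) auto
    also have "\<dots> = H *\<^sub>v (A *\<^sub>v v)" using H A v by (intro assoc_mult_mat_vec) auto
    also have "\<dots> = e \<cdot>\<^sub>v unit_vec ?N 0" unfolding Av using H(1) v Hv by (simp add: mult_mat_vec)
    finally show ?thesis .
  qed
  have B0: "B $$ (i,0) = (if i = 0 then e else 0)" if "i < ?N" for i
    using arg_cong[OF colB, of "\<lambda>w. w $ i"] B that by (auto simp: unit_vec_def)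
  have B0': "B $$ (0,i) = (if i = 0 then e else 0)" if "i < ?N" for i
    using arg_cong[OF Bsym, of "\<lambda>M. M $$ (0,i)"] B0[OF that] B that by auto
  define C where "C = mat n n (\<lambda>(i,j). B $$ (Suc i, Suc j))"
  have C: "C \<in> carrier_mat n n" unfolding C_def by simp
  have BC: "B = four_block_mat (mat 1 1 (\<lambda>_. e)) (0\<^sub>m 1 n) (0\<^sub>m n 1) C"
    using B B0 B0' by (intro eq_matI) (auto simp: C_def)
  have Csym: "transpose_mat C = C"
  proof (rule eq_matI)
    fix i j assume "i < dim_row C" "j < dim_col C"
    then show "transpose_mat C $$ (i,j) = C $$ (i,j)"
      using arg_cong[OF Bsym, of "\<lambda>M. M $$ (Suc i,Suc j)"] B by (auto simp: C_def)
  qed (use C in auto)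
  obtain es P where IH: "length es = n" "P \<in> carrier_mat n n" "transpose_mat P * P = 1\<^sub>m n"
    "C = P * diag_of_list es * transpose_mat P" "char_poly C = (\<Prod>e\<leftarrow>es. [:- e, 1:])"
    using Suc.IH[OF C Csym] by blast
  have D: "diag_of_list es \<in> carrier_mat n n" using IH(1) by (simp add: diag_of_list_def)
  define R where "R = four_block_mat (1\<^sub>m 1) (0\<^sub>m 1 n) (0\<^sub>m n 1) P"
  have R: "R \<in> carrier_mat ?N ?N" unfolding R_def using IH(2) four_block_carrier_mat[of "1\<^sub>m 1" 1 1 P n n] by simp
  have Rt: "transpose_mat R = four_block_mat (1\<^sub>m 1) (0\<^sub>m 1 n) (0\<^sub>m n 1) (transpose_mat P)"
    unfolding R_def using IH(2) by (subst transpose_four_block_mat[of _ 1 1 _ n _ n]) auto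
  have RR: "transpose_mat R * R = 1\<^sub>m ?N"
  proof -
    have "transpose_mat R * R = four_block_mat (1\<^sub>m 1) (0\<^sub>m 1 n) (0\<^sub>m n 1) (1\<^sub>m n)"
      unfolding Rt unfolding R_def using IH(2,3)
      by (subst mult_four_block_mat[of _ 1 1 _ n _ n _ _ 1 _ n]) auto
    then show ?thesis by (simp add: four_block_one_mat)
  qed
  have BR: "B = R * diag_of_list (e # es) * transpose_mat R"
    unfolding Rt unfolding R_def BC diag_of_list_Cons using IH(1,2,4) D
    apply (subst mult_four_block_mat[of _ 1 1 _ n _ n _ _ 1 _ n])
            apply auto
    apply (subst mult_four_block_mat[of _ 1 1 _ n _ n _ _ 1 _ n])
            apply auto
    done
  have Des: "diag_of_list (e # es) \<in> carrier_mat ?N ?N" using IH(1) by (simp add: diag_of_list_def)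
  have HR: "transpose_mat (H * R) = transpose_mat R * H"
    using H R by (subst transpose_mult[of _ ?N ?N _ ?N]) auto
  have "transpose_mat (H * R) * (H * R) = 1\<^sub>m ?N"
  proof -
    have "transpose_mat (H * R) * (H * R) = transpose_mat R * (H * H) * R"
      unfolding HR using H(1) R by (simp add: assoc_mult_mat[where n\<^sub>1="?N" and n\<^sub>2="?N" and n\<^sub>3="?N" and n\<^sub>4="?N"])
    then show ?thesis using H(2) R RR by simp
  qed
  moreover have "A = (H * R) * diag_of_list (e # es) * transpose_mat (H * R)"
    unfolding HR AB BR using H(1) R Des
    by (simp add: assoc_mult_mat[where n\<^sub>1="?N" and n\<^sub>2="?N" and n\<^sub>3="?N" and n\<^sub>4="?N"])
  moreover have "char_poly A = (\<Prod>e\<leftarrow>e # es. [:- e, 1:])"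
  proof -
    have "similar_mat_wit A B H H"
      using A B H AB by (intro similar_mat_witI[of _ _ ?N]) auto
    then have "char_poly A = char_poly B"
      by (intro char_poly_similar) (auto simp: similar_mat_def)
    also have "\<dots> = char_poly (mat 1 1 (\<lambda>_. e)) * char_poly C" unfolding BC
      using C by (subst char_poly_four_block_zeros_col) auto
    also have "char_poly (mat 1 1 (\<lambda>_. e)) = [:- e, 1:]"
      by (subst char_poly_upper_triangular[of _ 1]) (auto simp: diag_mat_def)
    finally show ?thesis using IH(5) by simp
  qed
  moreover have "H * R \<in> carrier_mat ?N ?N" using H R by simp
  ultimately show ?case using IH(1) by (intro exI[of _ "e # es"] exI[of _ "H * R"]) auto
qed

lemma proots_prod_linear:
  "proots (\<Prod>e\<leftarrow>es. [:- e, 1 :: real:]) = mset es"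
proof (induction es)
  case (Cons e es)
  have "(\<Prod>e\<leftarrow>es. [:- e, 1 :: real:]) \<noteq> 0"
    by (auto simp: prod_list_zero_iff)
  then show ?case using Cons by (simp add: proots_mult del: mult_pCons_left)
qed simp

text \<open>The spectral theorem in coordinates: the columns of \<open>U\<close> are an orthonormal
  eigenbasis, and the last three clauses are the diagonal quadratic form, Parseval's identity and
  the Frobenius norm (the trace of the squared matrix).\<close>

definition diagonalised_by :: "nat \<Rightarrow> real mat \<Rightarrow> real list \<Rightarrow> (nat \<Rightarrow> nat \<Rightarrow> real) \<Rightarrow> bool" where
  "diagonalised_by n A es U \<longleftrightarrow> length es = n \<and> char_poly A = (\<Prod>e\<leftarrow>es. [:- e, 1:]) \<and>
    (\<forall>w. (\<Sum>i<n. \<Sum>j<n. w i * A $$ (i,j) * w j) = (\<Sum>k<n. es ! k * (\<Sum>i<n. U i k * w i)\<^sup>2)) \<and>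
    (\<forall>w. (\<Sum>i<n. (w i)\<^sup>2) = (\<Sum>k<n. (\<Sum>i<n. U i k * w i)\<^sup>2)) \<and>
    (\<Sum>i<n. \<Sum>j<n. (A $$ (i,j))\<^sup>2) = (\<Sum>k<n. (es ! k)\<^sup>2)"

lemma real_symmetric_diagonalised:
  fixes A :: "real mat"
  assumes A: "A \<in> carrier_mat n n" and sym: "transpose_mat A = A"
  shows "\<exists>es U. diagonalised_by n A es U"
proof -
  obtain es P where P: "length es = n" "P \<in> carrier_mat n n" "transpose_mat P * P = 1\<^sub>m n"
    "A = P * diag_of_list es * transpose_mat P" "char_poly A = (\<Prod>e\<leftarrow>es. [:- e, 1:])"
    using real_symmetric_spectral[OF assms] by blast
  define U where "U i k = P $$ (i,k)" for i k
  have D: "diag_of_list es \<in> carrier_mat n n" using P(1) by (simp add: diag_of_list_def)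
  have PP: "P * transpose_mat P = 1\<^sub>m n"
    using mat_mult_left_right_inverse[of "transpose_mat P" n P] P(2,3) by simp
  have ortho: "(\<Sum>i<n. U i k * U i l) = (if k = l then 1 else 0)" if "k < n" "l < n" for k l
    using arg_cong[OF P(3), of "\<lambda>M. M $$ (k,l)"] P(2) that
    by (simp add: scalar_prod_def lessThan_atLeast0 U_def)
  have ortho': "(\<Sum>k<n. U i k * U j k) = (if i = j then 1 else 0)" if "i < n" "j < n" for i j
    using arg_cong[OF PP, of "\<lambda>M. M $$ (i,j)"] P(2) that
    by (simp add: scalar_prod_def lessThan_atLeast0 U_def)
  have PD: "(P * diag_of_list es) $$ (i,k) = es ! k * U i k" if "i < n" "k < n" for i k
  proof -
    have "(P * diag_of_list es) $$ (i,k) = (\<Sum>l<n. U i l * (if l = k then es ! l else 0))"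
      using that P(1,2) D
      by (subst index_mult_mat) (auto simp: scalar_prod_def diag_of_list_def U_def lessThan_atLeast0)
    also have "\<dots> = (\<Sum>l<n. if l = k then es ! k * U i k else 0)"
      by (intro sum.cong) auto
    finally show ?thesis using that by simp
  qed
  have entry: "A $$ (i,j) = (\<Sum>k<n. es ! k * U i k * U j k)" if ij: "i < n" "j < n" for i j
  proof -
    have "A $$ (i,j) = (\<Sum>k<n. (P * diag_of_list es) $$ (i,k) * U j k)"
      unfolding P(4) using ij P(1,2) D
      by (subst index_mult_mat) (auto simp: scalar_prod_def U_def lessThan_atLeast0)
    then show ?thesis using PD ij by simp
  qed
  \<comment> \<open>Kept general in the weights \<open>f\<close>: the eigenvalues give the quadratic
    form, constant weight 1 gives Parseval's identity.\<close>
  have quad: "(\<Sum>i<n. \<Sum>j<n. w i * (\<Sum>k<n. f k * U i k * U j k) * w j) =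
      (\<Sum>k<n. f k * (\<Sum>i<n. U i k * w i)\<^sup>2)" for f w
  proof -
    have "(\<Sum>i<n. \<Sum>j<n. w i * (\<Sum>k<n. f k * U i k * U j k) * w j) =
        (\<Sum>i<n. \<Sum>j<n. \<Sum>k<n. f k * ((U i k * w i) * (U j k * w j)))"
      by (simp add: sum_distrib_left sum_distrib_right algebra_simps)
    also have "\<dots> = (\<Sum>i<n. \<Sum>k<n. \<Sum>j<n. f k * ((U i k * w i) * (U j k * w j)))"
      by (intro sum.cong refl sum.swap)
    also have "\<dots> = (\<Sum>k<n. \<Sum>i<n. \<Sum>j<n. f k * ((U i k * w i) * (U j k * w j)))"
      by (rule sum.swap)
    finally show ?thesis by (simp add: power2_eq_square sum_product flip: sum_distrib_left)
  qed
  have 1: "(\<Sum>i<n. \<Sum>j<n. w i * A $$ (i,j) * w j) = (\<Sum>k<n. es ! k * (\<Sum>i<n. U i k * w i)\<^sup>2)" for w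
    unfolding quad[symmetric] by (intro sum.cong refl) (auto simp: entry)
  have 2: "(\<Sum>i<n. (w i)\<^sup>2) = (\<Sum>k<n. (\<Sum>i<n. U i k * w i)\<^sup>2)" for w
  proof -
    have "(\<Sum>k<n. 1 * (\<Sum>i<n. U i k * w i)\<^sup>2) = (\<Sum>i<n. \<Sum>j<n. w i * (if i = j then 1 else 0) * w j)"
      unfolding quad[symmetric] by (intro sum.cong refl) (auto simp: ortho')
    also have "\<dots> = (\<Sum>i<n. \<Sum>j<n. if i = j then w i * w i else 0)"
      by (intro sum.cong refl) auto
    also have "\<dots> = (\<Sum>i<n. (w i)\<^sup>2)"
      by (simp add: power2_eq_square)
    finally show ?thesis by simp
  qed
  \<comment> \<open>Parseval's identity is applied to column \<open>j\<close> of \<open>A\<close>,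
    whose coordinates in the eigenbasis are \<open>es ! k * U j k\<close>.\<close>
  have 3: "(\<Sum>i<n. \<Sum>j<n. (A $$ (i,j))\<^sup>2) = (\<Sum>k<n. (es ! k)\<^sup>2)"
  proof -
    have col: "(\<Sum>i<n. U i k * A $$ (i,j)) = es ! k * U j k" if "k < n" "j < n" for j k
    proof -
      have "(\<Sum>i<n. U i k * A $$ (i,j)) = (\<Sum>i<n. \<Sum>l<n. es ! l * U j l * (U i k * U i l))"
        using that by (intro sum.cong refl) (auto simp: entry sum_distrib_left algebra_simps)
      also have "\<dots> = (\<Sum>l<n. es ! l * U j l * (\<Sum>i<n. U i k * U i l))"
        by (subst sum.swap) (simp add: sum_distrib_left)
      also have "\<dots> = (\<Sum>l<n. if k = l then es ! l * U j l else 0)"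
        using that by (intro sum.cong refl) (auto simp: ortho)
      finally show ?thesis using that by simp
    qed
    have "(\<Sum>i<n. \<Sum>j<n. (A $$ (i,j))\<^sup>2) = (\<Sum>j<n. \<Sum>i<n. (A $$ (i,j))\<^sup>2)" by (rule sum.swap)
    also have "\<dots> = (\<Sum>j<n. \<Sum>k<n. (es ! k * U j k)\<^sup>2)"
    proof (rule sum.cong[OF refl])
      fix j assume "j \<in> {..<n}"
      then show "(\<Sum>i<n. (A $$ (i,j))\<^sup>2) = (\<Sum>k<n. (es ! k * U j k)\<^sup>2)"
        using 2[of "\<lambda>i. A $$ (i,j)"] col by simp
    qed
    also have "\<dots> = (\<Sum>k<n. \<Sum>j<n. (es ! k * U j k)\<^sup>2)" by (rule sum.swap)
    also have "\<dots> = (\<Sum>k<n. (es ! k)\<^sup>2 * (\<Sum>j<n. U j k * U j k))"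
      by (simp add: sum_distrib_left power2_eq_square algebra_simps)
    also have "\<dots> = (\<Sum>k<n. (es ! k)\<^sup>2)" by (intro sum.cong refl) (auto simp: ortho)
    finally show ?thesis .
  qed
  show ?thesis unfolding diagonalised_by_def using P(1,5) 1 2 3 by blast
qed

text \<open>The exception is a position, not a value: if the largest eigenvalue is repeated, its
  other copies are second largest and so at most \<open>c\<close>.\<close>

lemma at_most_one_above_second_largest:
  fixes es :: "real list"
  assumes len: "2 \<le> length es" and le: "rev (sorted_list_of_multiset (mset es)) ! 1 \<le> c"
  obtains k where "k < length es" "\<And>j. j < length es \<Longrightarrow> j \<noteq> k \<Longrightarrow> es ! j \<le> c"
proof -
  define ls where "ls = rev (sorted_list_of_multiset (mset es))"
  have ml: "mset ls = mset es" by (simp add: ls_def)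
  then have ll: "length ls = length es" by (metis size_mset)
  have srt: "sorted (rev ls)" by (simp add: ls_def)
  have le': "ls ! j \<le> c" if "1 \<le> j" "j < length ls" for j
    using sorted_rev_nth_mono[OF srt that] le by (simp add: ls_def)
  obtain x xs where ls: "ls = x # xs" using ll len by (cases ls) auto
  have xs: "y \<le> c" if "y \<in> set xs" for y
  proof -
    obtain j where "j < length xs" "xs ! j = y" using \<open>y \<in> set xs\<close> by (metis in_set_conv_nth)
    then show ?thesis using le'[of "Suc j"] ls by simp
  qed
  have "x \<in> set es" using ml ls by (metis list.set_intros(1) set_mset_mset)
  then obtain k where k: "k < length es" "es ! k = x" by (metis in_set_conv_nth)
  have "es ! j \<le> c" if j: "j < length es" "j \<noteq> k" for j
  proof -
    have "mset es = add_mset (es ! k) (mset (take k es @ drop (Suc k) es))"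
      using id_take_nth_drop[OF k(1)] by (metis mset.simps(2) mset_append union_mset_add_mset_right)
    then have "mset xs = mset (take k es @ drop (Suc k) es)" using ml ls k(2) by simp
    moreover have "es ! j \<in> set (take k es @ drop (Suc k) es)"
    proof (cases "j < k")
      case True
      then show ?thesis using j k by (auto simp: in_set_conv_nth)
    next
      case False
      then have "es ! j = drop (Suc k) es ! (j - Suc k)" using j by simp
      moreover have "j - Suc k < length (drop (Suc k) es)" using j False by auto
      ultimately show ?thesis by (metis Un_iff nth_mem set_append)
    qed
    ultimately show ?thesis using xs by (metis set_mset_mset)
  qed
  then show thesis using that k(1) by blast
qed

text \<open>One half of the Courant-Fischer principle: some nontrivial combination of
  \<open>u\<close> and \<open>v\<close> is orthogonal to the one eigenvector whose eigenvalue may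
  exceed \<open>c\<close>, and on its complement the form is at most \<open>c\<close> times the
  squared norm.\<close>

lemma second_eigenvalue_bounds_plane:
  fixes A :: "real mat"
  assumes A: "A \<in> carrier_mat n n" and sym: "transpose_mat A = A" and n: "2 \<le> n"
    and le: "rev (sorted_list_of_multiset (proots (char_poly A))) ! 1 \<le> c"
  shows "\<exists>a b. (a \<noteq> 0 \<or> b \<noteq> 0) \<and>
    (\<Sum>i<n. \<Sum>j<n. (a * u i + b * v i) * A $$ (i,j) * (a * u j + b * v j))
      \<le> c * (\<Sum>i<n. (a * u i + b * v i)\<^sup>2)"
proof -
  obtain es U where "diagonalised_by n A es U"
    using real_symmetric_diagonalised[OF A sym] by blast
  then have es: "length es = n" "char_poly A = (\<Prod>e\<leftarrow>es. [:- e, 1:])"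
    and q: "\<And>w. (\<Sum>i<n. \<Sum>j<n. w i * A $$ (i,j) * w j) = (\<Sum>k<n. es ! k * (\<Sum>i<n. U i k * w i)\<^sup>2)"
    and s: "\<And>w. (\<Sum>i<n. (w i)\<^sup>2) = (\<Sum>k<n. (\<Sum>i<n. U i k * w i)\<^sup>2)"
    unfolding diagonalised_by_def by blast+
  obtain k where k: "k < n" "\<And>j. j < n \<Longrightarrow> j \<noteq> k \<Longrightarrow> es ! j \<le> c"
    using at_most_one_above_second_largest[of es c] es n le by (auto simp: proots_prod_linear)
  define x where "x = (\<Sum>i<n. U i k * u i)"
  define y where "y = (\<Sum>i<n. U i k * v i)"
  obtain a b where ab: "a \<noteq> 0 \<or> b \<noteq> 0" "a * x + b * y = 0"
  proof (cases "x = 0")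
    case True then show ?thesis using that[of 1 0] by simp
  next
    case False then show ?thesis using that[of "-y" x] by simp
  qed
  let ?w = "\<lambda>i. a * u i + b * v i"
  have z: "(\<Sum>i<n. U i k * ?w i) = 0"
    using ab(2) by (simp add: x_def y_def sum_distrib_left algebra_simps sum.distrib)
  have "(\<Sum>j<n. es ! j * (\<Sum>i<n. U i j * ?w i)\<^sup>2) \<le> (\<Sum>j<n. c * (\<Sum>i<n. U i j * ?w i)\<^sup>2)"
  proof (intro sum_mono)
    fix j assume "j \<in> {..<n}"
    then show "es ! j * (\<Sum>i<n. U i j * ?w i)\<^sup>2 \<le> c * (\<Sum>i<n. U i j * ?w i)\<^sup>2"
      using k z by (cases "j = k") (auto intro: mult_right_mono)
  qed
  then have "(\<Sum>i<n. \<Sum>j<n. ?w i * A $$ (i,j) * ?w j) \<le> c * (\<Sum>i<n. (?w i)\<^sup>2)"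
    unfolding q s[of ?w] by (simp add: sum_distrib_left)
  then show ?thesis using ab(1) by blast
qed

section \<open>Graph distance\<close>

lemma walk_singleton: "u < n \<Longrightarrow> walk n E [u]"
  by (simp add: walk_def)

lemma walk_snoc:
  assumes "walk n E xs" "E (last xs) v" "v < n"
  shows "walk n E (xs @ [v])"
proof -
  have "E ((xs @ [v]) ! i) ((xs @ [v]) ! Suc i)" if i: "Suc i < length (xs @ [v])" for i
  proof (cases "Suc i < length xs")
    case True
    then show ?thesis using assms(1) by (auto simp: walk_def nth_append)
  next
    case False
    then have "Suc i = length xs" using i by simp
    moreover from this have "i < length xs" and "xs ! i = last xs"
      by (simp, metis Zero_not_Suc diff_Suc_1 last_conv_nth list.size(3))
    ultimately show ?thesis using assms(2) by (simp add: nth_append)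
  qed
  then show ?thesis using assms by (auto simp: walk_def)
qed

lemma walk_butlast:
  assumes "walk n E xs" "2 \<le> length xs"
  shows "walk n E (butlast xs)" "E (last (butlast xs)) (last xs)" "hd (butlast xs) = hd xs"
proof -
  have ne: "butlast xs \<noteq> []" using assms(2) by (cases xs rule: rev_cases) auto
  show "walk n E (butlast xs)" using assms ne unfolding walk_def
    by (auto simp: nth_butlast dest: in_set_butlastD)
  have "last (butlast xs) = xs ! (length xs - 2)"
    using ne assms(2) by (simp add: last_conv_nth nth_butlast numeral_2_eq_2)
  moreover have "last xs = xs ! Suc (length xs - 2)"
    using assms(2) by (subst last_conv_nth) (auto intro!: arg_cong[of _ _ "(!) xs"])
  ultimately show "E (last (butlast xs)) (last xs)"
    using assms unfolding walk_def by (auto intro!: arg_cong[of _ _ "(!) xs"])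
  show "hd (butlast xs) = hd xs" using ne by (cases xs) auto
qed

lemma walk_rev:
  assumes "walk n E xs" "\<And>u v. E u v \<Longrightarrow> E v u"
  shows "walk n E (rev xs)"
  unfolding walk_def
proof (intro conjI allI impI)
  fix i assume i: "Suc i < length (rev xs)"
  then have "E (xs ! (length xs - Suc (Suc i))) (xs ! Suc (length xs - Suc (Suc i)))"
    using assms(1) unfolding walk_def by auto
  moreover have "Suc (length xs - Suc (Suc i)) = length xs - Suc i" using i by simp
  ultimately show "E (rev xs ! i) (rev xs ! Suc i)"
    using i assms(2) by (simp add: rev_nth)
qed (use assms(1) in \<open>auto simp: walk_def\<close>)

locale conn_graph =
  fixes n :: nat and E :: "nat \<Rightarrow> nat \<Rightarrow> bool"
  assumes conn: "connected_graph n E"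
begin

abbreviation d :: "nat \<Rightarrow> nat \<Rightarrow> nat" where "d \<equiv> gdist n E"

lemma adj_less: "E u v \<Longrightarrow> u < n" "E u v \<Longrightarrow> v < n"
  and adj_sym: "E u v \<Longrightarrow> E v u"
  and adj_irrefl: "\<not> E u u"
  and n_pos: "0 < n"
  using conn by (auto simp: connected_graph_def simple_graph_def)

lemma dist_walk:
  assumes "u < n" "v < n"
  obtains xs where "walk n E xs" "hd xs = u" "last xs = v" "length xs = Suc (d u v)"
proof -
  obtain xs where "walk n E xs" "hd xs = u" "last xs = v"
    using conn assms unfolding connected_graph_def by blast
  moreover from this have "length xs = Suc (length xs - 1)" by (simp add: walk_def)
  ultimately have "\<exists>k xs. walk n E xs \<and> hd xs = u \<and> last xs = v \<and> length xs = Suc k" by blast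
  from LeastI_ex[OF this] show thesis using that unfolding gdist_def by blast
qed

lemma dist_le_walk:
  assumes "walk n E xs" "hd xs = u" "last xs = v" "length xs = Suc k"
  shows "d u v \<le> k"
  unfolding gdist_def by (rule Least_le) (use assms in blast)

lemma dist_refl [simp]: "u < n \<Longrightarrow> d u u = 0"
  using dist_le_walk[of "[u]" u u 0] by (simp add: walk_singleton)

lemma dist_eq_0:
  assumes "u < n" "v < n" "d u v = 0"
  shows "u = v"
proof -
  obtain xs where "hd xs = u" "last xs = v" "length xs = Suc 0"
    using dist_walk[OF assms(1,2)] assms(3) by metis
  then show ?thesis by (cases xs) auto
qed

lemma dist_sym:
  assumes "u < n" "v < n"
  shows "d u v = d v u"
proof -
  have "d v u \<le> d u v" if uv: "u < n" "v < n" for u v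
  proof -
    obtain xs where xs: "walk n E xs" "hd xs = u" "last xs = v" "length xs = Suc (d u v)"
      using dist_walk[OF uv] .
    have "walk n E (rev xs)" using walk_rev[OF xs(1)] adj_sym by blast
    then show ?thesis using xs by (intro dist_le_walk[of "rev xs"]) (auto simp: hd_rev last_rev)
  qed
  then show ?thesis using assms by (meson le_antisym)
qed

lemma dist_step_le:
  assumes "u < n" "E x v"
  shows "d u v \<le> Suc (d u x)"
proof -
  obtain xs where xs: "walk n E xs" "hd xs = u" "last xs = x" "length xs = Suc (d u x)"
    using dist_walk[OF assms(1) adj_less(1)[OF assms(2)]] .
  have "walk n E (xs @ [v])" using walk_snoc[OF xs(1)] xs(3) assms(2) adj_less by auto
  moreover have "hd (xs @ [v]) = u" using xs(2,4) by (cases xs) auto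
  ultimately show ?thesis using xs by (intro dist_le_walk[of "xs @ [v]"]) auto
qed

text \<open>The penultimate vertex of a shortest walk. Later arguments peel off the last edge in
  this way instead of handling walks.\<close>

lemma dist_pred:
  assumes "u < n" "v < n" "u \<noteq> v"
  obtains x where "E x v" "d u v = Suc (d u x)"
proof -
  obtain xs where xs: "walk n E xs" "hd xs = u" "last xs = v" "length xs = Suc (d u v)"
    using dist_walk[OF assms(1,2)] .
  have pos: "d u v \<noteq> 0" using dist_eq_0 assms by blast
  then have len: "2 \<le> length xs" using xs by simp
  note b = walk_butlast[OF xs(1) len]
  have "d u (last (butlast xs)) \<le> d u v - 1"
    by (rule dist_le_walk[OF b(1)]) (use b xs pos in auto)
  moreover have "E (last (butlast xs)) v" using b xs by simp
  moreover from this have "d u v \<le> Suc (d u (last (butlast xs)))"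
    using dist_step_le assms by blast
  ultimately show thesis using that[of "last (butlast xs)"] pos by auto
qed

lemma dist_adj: "E u v \<Longrightarrow> d u v = 1"
  using dist_step_le[of u u v] dist_eq_0[of u v] adj_less[of u v] adj_irrefl[of u] 
  by (cases "d u v") auto

lemma dist_eq_1_iff:
  assumes "u < n" "v < n"
  shows "d u v = 1 \<longleftrightarrow> E u v"
proof
  assume 1: "d u v = 1"
  then have "u \<noteq> v" using assms by auto
  then obtain x where "E x v" "d u v = Suc (d u x)" using dist_pred assms by blast
  then show "E u v" using 1 dist_eq_0[of u x] adj_less assms by fastforce
qed (rule dist_adj)

lemma dist_ge_2:
  assumes "u < n" "v < n" "u \<noteq> v" "\<not> E u v"
  shows "2 \<le> d u v"
  using dist_eq_0[of u v] dist_eq_1_iff[of u v] assms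
  by (metis One_nat_def Suc_1 Suc_leI le_neq_implies_less less_Suc_eq_0_disj not_less_eq_eq)

lemma dist_eq_2:
  assumes "u \<noteq> v" "\<not> E u v" "E u x" "E x v"
  shows "d u v = 2"
  using dist_ge_2[of u v] dist_step_le[of u x v] dist_adj[of u x] assms adj_less[of u x] adj_less[of x v]
  by fastforce

lemma dist_eq_2_common_neighbour:
  assumes "u < n" "v < n" "d u v = 2"
  obtains x where "E u x" "E x v"
proof -
  have "u \<noteq> v" using assms by auto
  then obtain x where "E x v" "d u v = Suc (d u x)" using dist_pred assms by blast
  then have "E u x" using dist_eq_1_iff[of u x] assms adj_less by simp
  then show thesis using that \<open>E x v\<close> by blast
qed

text \<open>Induction on the distance from \<open>x\<close>. It serves to show that a clique
  together with its pendant vertices exhausts the graph.\<close>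

lemma connected_closed_set:
  assumes "x \<in> S" "x < n" "\<And>u v. u \<in> S \<Longrightarrow> E u v \<Longrightarrow> v \<in> S" "y < n"
  shows "y \<in> S"
  using assms(4)
proof (induction "d x y" arbitrary: y)
  case 0
  then show ?case using dist_eq_0 assms by metis
next
  case (Suc k)
  then have "x \<noteq> y" using assms by auto
  then obtain z where "E z y" "d x y = Suc (d x z)" using dist_pred[of x y] Suc assms by blast
  moreover from this have "z \<in> S" using Suc adj_less(1) by (metis Suc_inject)
  ultimately show ?case using assms(3) by blast
qed

lemma dist_matrix_carrier: "dist_matrix n E \<in> carrier_mat n n"
  by (simp add: dist_matrix_def)

lemma dist_matrix_sym: "transpose_mat (dist_matrix n E) = dist_matrix n E"
  by (intro eq_matI) (auto simp: dist_matrix_def dist_sym)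

text \<open>These are the three invariants by which the graphs are compared: characteristic
  polynomial, order, and trace of the squared distance matrix.\<close>

lemma spectrum_char_poly:
  "char_poly (dist_matrix n E) = (\<Prod>e\<in>#D_spectrum n E. [:- e, 1:])"
  "size (D_spectrum n E) = n"
  "(\<Sum>i<n. \<Sum>j<n. (real (d i j))\<^sup>2) = (\<Sum>e\<in>#D_spectrum n E. e\<^sup>2)"
proof -
  let ?A = "dist_matrix n E"
  obtain es U where "diagonalised_by n ?A es U"
    using real_symmetric_diagonalised[OF dist_matrix_carrier dist_matrix_sym] by blast
  then have es: "length es = n" "char_poly ?A = (\<Prod>e\<leftarrow>es. [:- e, 1:])"
    and s: "(\<Sum>i<n. \<Sum>j<n. (?A $$ (i,j))\<^sup>2) = (\<Sum>k<n. (es ! k)\<^sup>2)"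
    unfolding diagonalised_by_def by blast+
  have sp: "D_spectrum n E = mset es" unfolding D_spectrum_def es(2) proots_prod_linear ..
  show "char_poly ?A = (\<Prod>e\<in>#D_spectrum n E. [:- e, 1:])"
    unfolding sp es(2) by (metis mset_map prod_mset_prod_list)
  show "size (D_spectrum n E) = n" unfolding sp using es by simp
  have "(\<Sum>i<n. \<Sum>j<n. (real (d i j))\<^sup>2) = (\<Sum>i<n. \<Sum>j<n. (?A $$ (i,j))\<^sup>2)"
    by (intro sum.cong refl) (auto simp: dist_matrix_def)
  also have "\<dots> = (\<Sum>e\<leftarrow>es. e\<^sup>2)" unfolding s
    using es(1) by (subst sum_list_sum_nth) (auto simp: lessThan_atLeast0)
  also have "\<dots> = (\<Sum>e\<in>#mset es. e\<^sup>2)" by (metis mset_map sum_mset_sum_list)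
  finally show "(\<Sum>i<n. \<Sum>j<n. (real (d i j))\<^sup>2) = (\<Sum>e\<in>#D_spectrum n E. e\<^sup>2)" unfolding sp .
qed

end

section \<open>Forbidden metric patterns\<close>

lemma pos_def_binary_form:
  fixes a b A B C :: real
  assumes "A > 0" "B\<^sup>2 < 4 * A * C" "A * a\<^sup>2 + B * (a * b) + C * b\<^sup>2 \<le> 0"
  shows "a = 0 \<and> b = 0"
proof -
  have "4 * A * (A * a\<^sup>2 + B * (a * b) + C * b\<^sup>2) = (2 * A * a + B * b)\<^sup>2 + (4 * A * C - B\<^sup>2) * b\<^sup>2"
    by (simp add: power2_eq_square algebra_simps)
  moreover have "4 * A * (A * a\<^sup>2 + B * (a * b) + C * b\<^sup>2) \<le> 0"
    using assms(1,3) by (simp add: mult_le_0_iff)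
  moreover have "(4 * A * C - B\<^sup>2) * b\<^sup>2 \<ge> 0" using assms(2) by simp
  moreover have "(2 * A * a + B * b)\<^sup>2 \<ge> 0" by simp
  ultimately have "(4 * A * C - B\<^sup>2) * b\<^sup>2 = 0" "(2 * A * a + B * b)\<^sup>2 = 0" by linarith+
  then show ?thesis using assms(1,2) by auto
qed

text \<open>With \<open>2 \<le> n\<close> the number \<open>D_eig n E 2\<close> is a genuine entry
  of the spectrum and not an out-of-range list access.\<close>

locale small_second = conn_graph +
  assumes two_le: "2 \<le> n" and small: "D_eig n E 2 \<le> (17 - sqrt 329) / 2"
begin

text \<open>A distance-preserving copy of a small metric space in the graph is a principal submatrix
  of the distance matrix, so it inherits the bound on the second largest eigenvalue; the lists
  \<open>us\<close>, \<open>vs\<close> are test vectors spanning a plane.\<close>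

lemma plane_test:
  assumes dist: "distinct ps" and sub: "set ps \<subseteq> {..<n}"
    and len: "length us = length ps" "length vs = length ps"
  shows "\<exists>a b. (a \<noteq> 0 \<or> b \<noteq> 0) \<and>
    (\<Sum>k<length ps. \<Sum>l<length ps. (a * us ! k + b * vs ! k) * real (d (ps ! k) (ps ! l)) * (a * us ! l + b * vs ! l))
      + 569/1000 * (\<Sum>k<length ps. (a * us ! k + b * vs ! k)\<^sup>2) \<le> 0"
proof -
  \<comment> \<open>Extension of a test vector by zero outside \<open>ps\<close>, which collapses
    sums over all vertices to sums over the pattern.\<close>
  define ext where "ext xs i = (case map_of (zip ps xs) i of None \<Rightarrow> 0 | Some x \<Rightarrow> x)" for xs :: "real list" and i
  have ext_nth: "ext xs (ps ! k) = xs ! k" if "length xs = length ps" "k < length ps" for xs k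
    using that dist by (simp add: ext_def map_of_zip_nth)
  have ext_out: "ext xs i = 0" if "i \<notin> set ps" for xs i
  proof -
    have "i \<notin> dom (map_of (zip ps xs))"
      using that by (auto simp: dom_map_of_conv_image_fst dest: set_zip_leftD)
    then show ?thesis by (auto simp: ext_def domIff)
  qed
  let ?w = "\<lambda>a b i. a * ext us i + b * ext vs i"
  have reindex: "(\<Sum>i<n. f i) = (\<Sum>k<length ps. f (ps ! k))" if "\<And>i. i \<notin> set ps \<Longrightarrow> f i = 0" for f :: "nat \<Rightarrow> real"
  proof -
    have "(\<Sum>i<n. f i) = (\<Sum>i\<in>set ps. f i)"
      by (rule sum.mono_neutral_right) (use sub that in auto)
    also have "\<dots> = (\<Sum>k<length ps. f (ps ! k))"
      by (rule sum.reindex_bij_betw[symmetric]) (use dist bij_betw_nth in blast)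
    finally show ?thesis .
  qed
  obtain a b where ab: "a \<noteq> 0 \<or> b \<noteq> 0"
    and le: "(\<Sum>i<n. \<Sum>j<n. ?w a b i * dist_matrix n E $$ (i,j) * ?w a b j)
      \<le> (17 - sqrt 329) / 2 * (\<Sum>i<n. (?w a b i)\<^sup>2)"
    using second_eigenvalue_bounds_plane[OF dist_matrix_carrier dist_matrix_sym two_le, of "(17 - sqrt 329) / 2" "ext us" "ext vs"] small
    unfolding D_eig_def D_spectrum_def by auto
  \<comment> \<open>18.138^2 = 328.987044 lies just below 329, and (17 - 18.138)/2 is exactly
    -0.569. The rational threshold turns every pattern test into rational arithmetic.\<close>
  have "sqrt 329 \<ge> 18138/1000" by (rule real_le_rsqrt) (simp add: power2_eq_square)
  then have c: "(17 - sqrt 329) / 2 \<le> - 569/1000" by simp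
  have q: "(\<Sum>i<n. \<Sum>j<n. ?w a b i * dist_matrix n E $$ (i,j) * ?w a b j) =
    (\<Sum>k<length ps. \<Sum>l<length ps. (a * us ! k + b * vs ! k) * real (d (ps ! k) (ps ! l)) * (a * us ! l + b * vs ! l))"
  proof -
    have "(\<Sum>i<n. \<Sum>j<n. ?w a b i * dist_matrix n E $$ (i,j) * ?w a b j) =
      (\<Sum>i<n. \<Sum>j<n. ?w a b i * real (d i j) * ?w a b j)"
      by (intro sum.cong refl) (auto simp: dist_matrix_def)
    also have "\<dots> = (\<Sum>k<length ps. \<Sum>j<n. ?w a b (ps ! k) * real (d (ps ! k) j) * ?w a b j)"
      by (rule reindex) (simp add: ext_out)
    also have "\<dots> = (\<Sum>k<length ps. \<Sum>l<length ps. ?w a b (ps ! k) * real (d (ps ! k) (ps ! l)) * ?w a b (ps ! l))"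
      by (intro sum.cong refl reindex) (simp add: ext_out)
    finally show ?thesis using len by (simp add: ext_nth)
  qed
  have s: "(\<Sum>i<n. (?w a b i)\<^sup>2) = (\<Sum>k<length ps. (a * us ! k + b * vs ! k)\<^sup>2)"
  proof -
    have "(\<Sum>i<n. (?w a b i)\<^sup>2) = (\<Sum>k<length ps. (?w a b (ps ! k))\<^sup>2)"
      by (rule reindex) (simp add: ext_out)
    then show ?thesis using len by (simp add: ext_nth)
  qed
  have "(17 - sqrt 329) / 2 * (\<Sum>i<n. (?w a b i)\<^sup>2) \<le> - 569/1000 * (\<Sum>i<n. (?w a b i)\<^sup>2)"
    by (rule mult_right_mono[OF c]) (auto intro: sum_nonneg)
  then show ?thesis using ab le unfolding q s by (intro exI[of _ a] exI[of _ b]) auto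
qed

text \<open>The bilinear form of \<open>D + 0.569 I\<close> restricted to the points
  \<open>ps\<close>.\<close>

definition test_form :: "nat list \<Rightarrow> real list \<Rightarrow> real list \<Rightarrow> real" where
  "test_form ps us vs =
    (\<Sum>k<length ps. \<Sum>l<length ps. us ! k * real (d (ps ! k) (ps ! l)) * vs ! l)
    + 569/1000 * (\<Sum>k<length ps. us ! k * vs ! k)"

text \<open>By \<open>plane_test\<close> the form cannot be positive definite in the coefficients of
  the two test vectors, so the determinant of its 2-by-2 matrix is not positive. The two cross terms
  are added rather than one of them doubled, which spares an appeal to the symmetry of
  \<open>d\<close>.\<close>

lemma test_form_not_pos_def:
  assumes "distinct ps" "set ps \<subseteq> {..<n}" "length us = length ps" "length vs = length ps"
    and "test_form ps us us > 0"
  shows "4 * test_form ps us us * test_form ps vs vs \<le> (test_form ps us vs + test_form ps vs us)\<^sup>2"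
proof (rule ccontr)
  assume neg: "\<not> ?thesis"
  let ?m = "length ps"
  obtain a b where ab: "a \<noteq> 0 \<or> b \<noteq> 0" and le:
    "(\<Sum>k<?m. \<Sum>l<?m. (a * us ! k + b * vs ! k) * real (d (ps ! k) (ps ! l)) * (a * us ! l + b * vs ! l))
      + 569/1000 * (\<Sum>k<?m. (a * us ! k + b * vs ! k)\<^sup>2) \<le> 0"
    using plane_test[OF assms(1-4)] by blast
  have 1: "(\<Sum>k<?m. \<Sum>l<?m. (a * us ! k + b * vs ! k) * real (d (ps ! k) (ps ! l)) * (a * us ! l + b * vs ! l)) =
    a\<^sup>2 * (\<Sum>k<?m. \<Sum>l<?m. us ! k * real (d (ps ! k) (ps ! l)) * us ! l)
    + (a * b) * ((\<Sum>k<?m. \<Sum>l<?m. us ! k * real (d (ps ! k) (ps ! l)) * vs ! l)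
      + (\<Sum>k<?m. \<Sum>l<?m. vs ! k * real (d (ps ! k) (ps ! l)) * us ! l))
    + b\<^sup>2 * (\<Sum>k<?m. \<Sum>l<?m. vs ! k * real (d (ps ! k) (ps ! l)) * vs ! l)"
    unfolding sum_distrib_left sum.distrib[symmetric]
    by (intro sum.cong refl) (simp add: power2_eq_square algebra_simps)
  have 2: "(\<Sum>k<?m. (a * us ! k + b * vs ! k)\<^sup>2) =
    a\<^sup>2 * (\<Sum>k<?m. us ! k * us ! k) + (a * b) * ((\<Sum>k<?m. us ! k * vs ! k) + (\<Sum>k<?m. vs ! k * us ! k))
    + b\<^sup>2 * (\<Sum>k<?m. vs ! k * vs ! k)"
    unfolding sum_distrib_left sum.distrib[symmetric]
    by (intro sum.cong refl) (simp add: power2_eq_square algebra_simps)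
  have "test_form ps us us * a\<^sup>2 + (test_form ps us vs + test_form ps vs us) * (a * b)
      + test_form ps vs vs * b\<^sup>2 \<le> 0"
    using le unfolding 1 2 test_form_def by (simp add: algebra_simps)
  moreover have "(test_form ps us vs + test_form ps vs us)\<^sup>2 < 4 * test_form ps us us * test_form ps vs vs"
    using neg by simp
  ultimately show False using pos_def_binary_form[OF assms(5)] ab by blast
qed

text \<open>The test vectors below are rounded eigenvectors of the two largest eigenvalues of the
  respective pattern. The tightest case is the lollipop, whose second largest eigenvalue is about
  \<open>-0.56858\<close>; the threshold \<open>-0.569\<close> separates it from the bound \<open>-0.56918\<close>.\<close>

lemma no_metric_C4:
  assumes lt: "p < n" "q < n" "r < n" "s < n"
    and D: "d p q = 1" "d q r = 1" "d r s = 1" "d p s = 1" "d p r = 2" "d q s = 2"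
  shows False
proof -
  have ne: "distinct [p,q,r,s]" using lt D by auto
  have D': "d q p = 1" "d r q = 1" "d s r = 1" "d s p = 1" "d r p = 2" "d s q = 2"
    using D lt dist_sym by auto
  have F: "test_form [p,q,r,s] [1,1,1,1] [1,1,1,1] = 4569/250"
    "test_form [p,q,r,s] [1,1,1,1] [-1,1,-1,1] = 0"
    "test_form [p,q,r,s] [-1,1,-1,1] [1,1,1,1] = 0"
    "test_form [p,q,r,s] [-1,1,-1,1] [-1,1,-1,1] = 569/250"
    by (simp_all add: test_form_def sum.lessThan_Suc D D' lt)
  show False
    using test_form_not_pos_def[of "[p,q,r,s]" "[1,1,1,1]" "[-1,1,-1,1]", unfolded F] lt ne by (simp add: power2_eq_square)
qed

lemma no_metric_diamond:
  assumes lt: "p < n" "q < n" "r < n" "s < n"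
    and D: "d p q = 1" "d q r = 1" "d r s = 1" "d p s = 1" "d p r = 1" "d q s = 2"
  shows False
proof -
  have ne: "distinct [p,q,r,s]" using lt D by auto
  have D': "d q p = 1" "d r q = 1" "d s r = 1" "d s p = 1" "d r p = 1" "d s q = 2"
    using D lt dist_sym by auto
  have F: "test_form [p,q,r,s] [1,1,1,1] [1,1,1,1] = 4069/250"
    "test_form [p,q,r,s] [1,1,1,1] [1,-1,1,-1] = -2"
    "test_form [p,q,r,s] [1,-1,1,-1] [1,1,1,1] = -2"
    "test_form [p,q,r,s] [1,-1,1,-1] [1,-1,1,-1] = 69/250"
    by (simp_all add: test_form_def sum.lessThan_Suc D D' lt)
  show False
    using test_form_not_pos_def[of "[p,q,r,s]" "[1,1,1,1]" "[1,-1,1,-1]", unfolded F] lt ne by (simp add: power2_eq_square)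
qed

lemma no_metric_C5:
  assumes lt: "p < n" "q < n" "r < n" "s < n" "t < n"
    and D: "d p q = 1" "d q r = 1" "d r s = 1" "d s t = 1" "d p t = 1" "d p r = 2" "d q s = 2" "d r t = 2" "d p s = 2" "d q t = 2"
  shows False
proof -
  have ne: "distinct [p,q,r,s,t]" using lt D by auto
  have D': "d q p = 1" "d r q = 1" "d s r = 1" "d t s = 1" "d t p = 1" "d r p = 2" "d s q = 2" "d t r = 2" "d s p = 2" "d t q = 2"
    using D lt dist_sym by auto
  have F: "test_form [p,q,r,s,t] [1,1,1,1,1] [1,1,1,1,1] = 6569/200"
    "test_form [p,q,r,s,t] [1,1,1,1,1] [-1,1,0,-1,1] = 0"
    "test_form [p,q,r,s,t] [-1,1,0,-1,1] [1,1,1,1,1] = 0"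
    "test_form [p,q,r,s,t] [-1,1,0,-1,1] [-1,1,0,-1,1] = 69/250"
    by (simp_all add: test_form_def sum.lessThan_Suc D D' lt)
  show False
    using test_form_not_pos_def[of "[p,q,r,s,t]" "[1,1,1,1,1]" "[-1,1,0,-1,1]", unfolded F] lt ne by (simp add: power2_eq_square)
qed

text \<open>The metric of five consecutive vertices t, p, q, r, s of a 6-cycle.\<close>

lemma no_metric_P4_prolonged_2:
  assumes lt: "p < n" "q < n" "r < n" "s < n" "t < n"
    and D: "d p q = 1" "d q r = 1" "d r s = 1" "d p r = 2" "d q s = 2" "d p s = 3" "d p t = 1" "d q t = 2" "d r t = 3" "d s t = 2"
  shows False
proof -
  have ne: "distinct [p,q,r,s,t]" using lt D by auto
  have D': "d q p = 1" "d r q = 1" "d s r = 1" "d r p = 2" "d s q = 2" "d s p = 3" "d t p = 1" "d t q = 2" "d t r = 3" "d t s = 2"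
    using D lt dist_sym by auto
  have F: "test_form [p,q,r,s,t] [1,1,1,1,1] [1,1,1,1,1] = 7769/200"
    "test_form [p,q,r,s,t] [1,1,1,1,1] [-1,0,1,-1,1] = 0"
    "test_form [p,q,r,s,t] [-1,0,1,-1,1] [1,1,1,1,1] = 0"
    "test_form [p,q,r,s,t] [-1,0,1,-1,1] [-1,0,1,-1,1] = 569/250"
    by (simp_all add: test_form_def sum.lessThan_Suc D D' lt)
  show False
    using test_form_not_pos_def[of "[p,q,r,s,t]" "[1,1,1,1,1]" "[-1,0,1,-1,1]", unfolded F] lt ne by (simp add: power2_eq_square)
qed

text \<open>The metric of five consecutive vertices t, p, q, r, s of a 7-cycle.\<close>

lemma no_metric_P4_prolonged_3:
  assumes lt: "p < n" "q < n" "r < n" "s < n" "t < n"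
    and D: "d p q = 1" "d q r = 1" "d r s = 1" "d p r = 2" "d q s = 2" "d p s = 3" "d p t = 1" "d q t = 2" "d r t = 3" "d s t = 3"
  shows False
proof -
  have ne: "distinct [p,q,r,s,t]" using lt D by auto
  have D': "d q p = 1" "d r q = 1" "d s r = 1" "d r p = 2" "d s q = 2" "d s p = 3" "d t p = 1" "d t q = 2" "d t r = 3" "d t s = 3"
    using D lt dist_sym by auto
  have F: "test_form [p,q,r,s,t] [1,1,1,1,1] [1,1,1,1,1] = 8169/200"
    "test_form [p,q,r,s,t] [1,1,1,1,1] [-1,0,1,-1,1] = 0"
    "test_form [p,q,r,s,t] [-1,0,1,-1,1] [1,1,1,1,1] = 0"
    "test_form [p,q,r,s,t] [-1,0,1,-1,1] [-1,0,1,-1,1] = 69/250"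
    by (simp_all add: test_form_def sum.lessThan_Suc D D' lt)
  show False
    using test_form_not_pos_def[of "[p,q,r,s,t]" "[1,1,1,1,1]" "[-1,0,1,-1,1]", unfolded F] lt ne by (simp add: power2_eq_square)
qed

text \<open>The metric of the path t, p, q, r, s on five vertices.\<close>

lemma no_metric_P4_prolonged_4:
  assumes lt: "p < n" "q < n" "r < n" "s < n" "t < n"
    and D: "d p q = 1" "d q r = 1" "d r s = 1" "d p r = 2" "d q s = 2" "d p s = 3" "d p t = 1" "d q t = 2" "d r t = 3" "d s t = 4"
  shows False
proof -
  have ne: "distinct [p,q,r,s,t]" using lt D by auto
  have D': "d q p = 1" "d r q = 1" "d s r = 1" "d r p = 2" "d s q = 2" "d s p = 3" "d t p = 1" "d t q = 2" "d t r = 3" "d t s = 4"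
    using D lt dist_sym by auto
  have F: "test_form [p,q,r,s,t] [1,1,1,2,2] [1,1,1,2,2] = 94259/1000"
    "test_form [p,q,r,s,t] [1,1,1,2,2] [-1,1,-1,0,0] = -12569/1000"
    "test_form [p,q,r,s,t] [-1,1,-1,0,0] [1,1,1,2,2] = -12569/1000"
    "test_form [p,q,r,s,t] [-1,1,-1,0,0] [-1,1,-1,0,0] = 1707/1000"
    by (simp_all add: test_form_def sum.lessThan_Suc D D' lt)
  show False
    using test_form_not_pos_def[of "[p,q,r,s,t]" "[1,1,1,2,2]" "[-1,1,-1,0,0]", unfolded F] lt ne by (simp add: power2_eq_square)
qed

text \<open>A triangle p, q, t with the path q, r, s attached at q.\<close>

lemma no_metric_lollipop:
  assumes lt: "p < n" "q < n" "r < n" "s < n" "t < n"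
    and D: "d p q = 1" "d q r = 1" "d r s = 1" "d p r = 2" "d q s = 2" "d p s = 3" "d p t = 1" "d q t = 1" "d r t = 2" "d s t = 3"
  shows False
proof -
  have ne: "distinct [p,q,r,s,t]" using lt D by auto
  have D': "d q p = 1" "d r q = 1" "d s r = 1" "d r p = 2" "d s q = 2" "d s p = 3" "d t p = 1" "d t q = 1" "d t r = 2" "d t s = 3"
    using D lt dist_sym by auto
  have F: "test_form [p,q,r,s,t] [1,1,1,1,1] [1,1,1,1,1] = 7369/200"
    "test_form [p,q,r,s,t] [1,1,1,1,1] [2,-10,9,-4,2] = -4569/1000"
    "test_form [p,q,r,s,t] [2,-10,9,-4,2] [1,1,1,1,1] = -4569/1000"
    "test_form [p,q,r,s,t] [2,-10,9,-4,2] [2,-10,9,-4,2] = 129/200"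
    by (simp_all add: test_form_def sum.lessThan_Suc D D' lt)
  show False
    using test_form_not_pos_def[of "[p,q,r,s,t]" "[1,1,1,1,1]" "[2,-10,9,-4,2]", unfolded F] lt ne by (simp add: power2_eq_square)
qed

text \<open>A tree: the vertex q carries the leaves p and t and the path q, r, s.\<close>

lemma no_metric_fork:
  assumes lt: "p < n" "q < n" "r < n" "s < n" "t < n"
    and D: "d p q = 1" "d q r = 1" "d r s = 1" "d p r = 2" "d q s = 2" "d p s = 3" "d p t = 2" "d q t = 1" "d r t = 2" "d s t = 3"
  shows False
proof -
  have ne: "distinct [p,q,r,s,t]" using lt D by auto
  have D': "d q p = 1" "d r q = 1" "d s r = 1" "d r p = 2" "d s q = 2" "d s p = 3" "d t p = 2" "d t q = 1" "d t r = 2" "d t s = 3"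
    using D lt dist_sym by auto
  have F: "test_form [p,q,r,s,t] [1,1,1,1,1] [1,1,1,1,1] = 7769/200"
    "test_form [p,q,r,s,t] [1,1,1,1,1] [0,-2,1,-1,0] = -7069/500"
    "test_form [p,q,r,s,t] [0,-2,1,-1,0] [1,1,1,1,1] = -7069/500"
    "test_form [p,q,r,s,t] [0,-2,1,-1,0] [0,-2,1,-1,0] = 2707/500"
    by (simp_all add: test_form_def sum.lessThan_Suc D D' lt)
  show False
    using test_form_not_pos_def[of "[p,q,r,s,t]" "[1,1,1,1,1]" "[0,-2,1,-1,0]", unfolded F] lt ne by (simp add: power2_eq_square)
qed

end

section \<open>Classification\<close>

text \<open>Off the hub, "equal or adjacent" is an equivalence relation, and its classes are the
  blades; transitivity thus encodes the disjoint cliques without choosing a partition. A complete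
  graph also fits, with at most one blade, so a non-adjacent pair is carried along where two blades
  matter.\<close>

definition windmill :: "nat \<Rightarrow> (nat \<Rightarrow> nat \<Rightarrow> bool) \<Rightarrow> nat \<Rightarrow> bool" where
  "windmill n E z \<longleftrightarrow> z < n \<and> (\<forall>v<n. v \<noteq> z \<longrightarrow> E z v) \<and>
    (\<forall>u v x. u \<noteq> z \<longrightarrow> v \<noteq> z \<longrightarrow> x \<noteq> z \<longrightarrow> u \<noteq> x \<longrightarrow> E u v \<longrightarrow> E v x \<longrightarrow> E u x)"

text \<open>With fewer than two pendant vertices the graph is already complete or a windmill. Two
  pendant vertices are at distance 3, which no windmill allows.\<close>

definition clique_with_pendants :: "nat \<Rightarrow> (nat \<Rightarrow> nat \<Rightarrow> bool) \<Rightarrow> nat set \<Rightarrow> bool" where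
  "clique_with_pendants n E K \<longleftrightarrow> K \<subseteq> {..<n} \<and> (\<forall>x\<in>K. \<forall>y\<in>K. x \<noteq> y \<longrightarrow> E x y) \<and>
    (\<forall>v\<in>{..<n} - K. \<exists>u\<in>K. \<forall>x. E v x \<longleftrightarrow> x = u) \<and>
    (\<forall>u\<in>K. \<forall>v\<in>{..<n} - K. \<forall>w\<in>{..<n} - K. E u v \<longrightarrow> E u w \<longrightarrow> v = w) \<and>
    2 \<le> card ({..<n} - K)"

context small_second
begin

text \<open>Two common neighbours would complete a diamond or a 4-cycle, according to whether they
  are adjacent. Non-adjacent vertices in these patterns share a neighbour, so the patterns are
  isometric.\<close>

lemma common_neighbour_unique:
  assumes "u \<noteq> v" "\<not> E u v" "E u x" "E x v" "E u y" "E y v"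
  shows "x = y"
proof (rule ccontr)
  assume ne: "x \<noteq> y"
  have lt: "u < n" "v < n" "x < n" "y < n" using assms adj_less by blast+
  have 1: "d u x = 1" "d x v = 1" "d v y = 1" "d u y = 1" "d u v = 2" "d x u = 1" "d v x = 1" "d y v = 1" "d y u = 1"
    using assms adj_sym dist_adj dist_eq_2[of u v x] by blast+
  show False
  proof (cases "E x y")
    case True
    then show False using no_metric_diamond[of x v y u] lt 1 dist_adj[OF True] dist_sym[of u v] by simp
  next
    case False
    then have "d x y = 2" using dist_eq_2[of x y u] ne assms adj_sym by blast
    then show False using no_metric_C4[of u x v y] lt 1 by simp
  qed
qed

definition induced_P4 :: "nat \<Rightarrow> nat \<Rightarrow> nat \<Rightarrow> nat \<Rightarrow> bool" where
  "induced_P4 p q r s \<longleftrightarrow> E p q \<and> E q r \<and> E r s \<and> p \<noteq> r \<and> q \<noteq> s \<and> \<not> E p r \<and> \<not> E q s \<and> \<not> E p s"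

lemma induced_P4_rev: "induced_P4 p q r s \<Longrightarrow> induced_P4 s r q p"
  unfolding induced_P4_def using adj_sym by blast

text \<open>The ends could be closer than 3 only through a common neighbour x. Uniqueness of common
  neighbours then rules out the chords from x to q and r, and p, q, r, s, x is an isometric
  5-cycle.\<close>

lemma induced_P4_dist:
  assumes P: "induced_P4 p q r s"
  shows "d p q = 1" "d q r = 1" "d r s = 1" "d p r = 2" "d q s = 2" "d p s = 3"
proof -
  have e: "E p q" "E q r" "E r s" and ne: "p \<noteq> r" "q \<noteq> s" "\<not> E p r" "\<not> E q s" "\<not> E p s"
    using P by (auto simp: induced_P4_def)
  have lt: "p < n" "q < n" "r < n" "s < n" using e adj_less by blast+
  have ps: "p \<noteq> s" using e ne adj_sym by blast
  show 1: "d p q = 1" "d q r = 1" "d r s = 1" using e dist_adj by auto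
  show 2: "d p r = 2" "d q s = 2" using dist_eq_2 e ne by blast+
  have "d p s \<le> 3" using dist_step_le[OF lt(1) e(3)] 2 by simp
  moreover have "d p s \<ge> 2" using dist_ge_2 lt ps ne by blast
  moreover have "d p s \<noteq> 2"
  proof
    assume d2: "d p s = 2"
    obtain x where x: "E p x" "E x s" using dist_eq_2_common_neighbour[OF lt(1,4) d2] .
    have xlt: "x < n" using x adj_less by blast
    have xne: "x \<noteq> q" "x \<noteq> r" using x ne by auto
    have "\<not> E x r" using common_neighbour_unique[of p r x q] ne e x xne by blast
    then have "d r x = 2" using dist_eq_2[of r x s] x e xne adj_sym by blast
    moreover have "\<not> E q x" using common_neighbour_unique[of q s x r] ne e x xne by blast
    then have "d q x = 2" using dist_eq_2[of q x p] x e xne adj_sym by blast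
    moreover have "d s x = 1" "d p x = 1" using x dist_adj adj_sym by blast+
    ultimately show False using no_metric_C5[OF lt xlt] 1 2 d2 by blast
  qed
  ultimately show "d p s = 3" by linarith
qed

text \<open>A second neighbour v of p is adjacent neither to r, as q is the only common neighbour of
  p and r, nor to s, which is at distance 3 from p. So only the edge between v and q is open:
  present it gives the lollipop, absent it gives a prolonged path with \<open>d s v\<close> equal to
  2, 3 or 4.\<close>

lemma induced_P4_end:
  assumes P: "induced_P4 p q r s" and v: "E p v"
  shows "v = q"
proof (rule ccontr)
  assume vq: "v \<noteq> q"
  have e: "E p q" "E q r" "E r s" and ne: "p \<noteq> r" "q \<noteq> s" "\<not> E p r" "\<not> E q s" "\<not> E p s"
    using P by (auto simp: induced_P4_def)
  have lt: "p < n" "q < n" "r < n" "s < n" "v < n" using e v adj_less by blast+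
  note D = induced_P4_dist[OF P]
  have pv: "d p v = 1" using v dist_adj by blast
  have vr: "\<not> E v r" "v \<noteq> r" using common_neighbour_unique[of p r v q] ne e v vq by blast+
  have vs: "\<not> E v s"
    using dist_step_le[of p v s] lt pv D by fastforce
  show False
  proof (cases "E v q")
    case True
    then have "d q v = 1" using dist_adj adj_sym by blast
    moreover have "d r v = 2" using dist_eq_2[of r v q] True e vr adj_sym by blast
    moreover have "induced_P4 v q r s" unfolding induced_P4_def using True e ne vr vs by blast
    then have "d s v = 3" using induced_P4_dist(6) dist_sym lt by metis
    ultimately show False using no_metric_lollipop[OF lt D(1-3)] D pv by blast
  next
    case False
    have "induced_P4 v p q r" unfolding induced_P4_def using e ne v vq False vr adj_sym by blast
    then have rv: "d r v = 3" using induced_P4_dist(6) dist_sym lt by metis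
    have qv: "d q v = 2" using dist_eq_2[of q v p] False e v vq adj_sym by blast
    have "d s v \<le> 4" using dist_step_le[of s p v] v lt D(6) dist_sym[of s p] by simp
    moreover have "d s v \<noteq> 0" using dist_eq_0[of s v] lt e vr adj_sym vs v ne by blast
    moreover have "d s v \<noteq> 1" using dist_eq_1_iff[of s v] lt vs adj_sym by blast
    ultimately consider "d s v = 2" | "d s v = 3" | "d s v = 4" by linarith
    then show False
      using no_metric_P4_prolonged_2[OF lt] no_metric_P4_prolonged_3[OF lt]
        no_metric_P4_prolonged_4[OF lt] D pv qv rv by cases blast+
  qed
qed

text \<open>A vertex attached to q but not to r would give the fork. What survives is the bull, in
  which v sees exactly the two inner vertices.\<close>

lemma induced_P4_middle:
  assumes P: "induced_P4 p q r s" and v: "E q v" "v \<noteq> p" "v \<noteq> r"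
  shows "E r v"
proof (rule ccontr)
  assume rv: "\<not> E r v"
  have e: "E p q" "E q r" "E r s" and ne: "p \<noteq> r" "q \<noteq> s" "\<not> E p r" "\<not> E q s" "\<not> E p s"
    using P by (auto simp: induced_P4_def)
  have lt: "p < n" "q < n" "r < n" "s < n" "v < n" using e v adj_less by blast+
  note D = induced_P4_dist[OF P]
  have pv: "\<not> E p v" using induced_P4_end[OF P] v adj_irrefl by blast
  have vs: "\<not> E v s" using common_neighbour_unique[of q s v r] ne e v by blast
  have "induced_P4 v q r s" unfolding induced_P4_def using e ne v rv vs adj_sym by blast
  then have "d s v = 3" using induced_P4_dist(6) dist_sym lt by metis
  moreover have "d p v = 2" "d r v = 2" "d q v = 1"
    using dist_eq_2[of p v q] dist_eq_2[of r v q] dist_adj e v pv rv adj_sym by blast+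
  ultimately show False using no_metric_fork[OF lt] D by blast
qed

text \<open>The last four vertices of a shortest walk of length at least 3 form an induced
  \<open>P4\<close>.\<close>

lemma dist_le_2_if_P4_free:
  assumes free: "\<And>p q r s. \<not> induced_P4 p q r s" and "a < n" "b < n"
  shows "d a b \<le> 2"
proof (rule ccontr)
  assume "\<not> ?thesis"
  then have 3: "d a b \<ge> 3" by simp
  then have "a \<noteq> b" using assms by auto
  then obtain x where x: "E x b" "d a b = Suc (d a x)" using dist_pred assms by blast
  then have "a \<noteq> x" using 3 assms by auto
  then obtain y where y: "E y x" "d a x = Suc (d a y)" using dist_pred[of a x] x assms adj_less by blast
  then have "a \<noteq> y" using 3 x assms by auto
  then obtain w where w: "E w y" "d a y = Suc (d a w)" using dist_pred[of a y] y assms adj_less by blast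
  have "\<not> E w x" using dist_step_le[of a w x] assms(2) y w by auto
  moreover have "\<not> E y b" using dist_step_le[of a y b] assms(2) x y by auto
  moreover have "\<not> E w b" using dist_step_le[of a w b] assms(2) x y w by auto
  moreover have "w \<noteq> x" "y \<noteq> b" using x y w by auto
  ultimately have "induced_P4 w y x b" unfolding induced_P4_def using x y w by blast
  then show False using free by blast
qed

text \<open>The hub is the common neighbour z of any non-adjacent pair. A vertex w missing from the
  neighbourhood of z would be at distance 2 from z, and w, a middle vertex y, z and a suitable c
  would form an induced \<open>P4\<close>.\<close>

lemma P4_free_windmill:
  assumes free: "\<And>p q r s. \<not> induced_P4 p q r s"
    and ab: "a < n" "b < n" "a \<noteq> b" "\<not> E a b"
  shows "\<exists>z. windmill n E z"
proof -
  have "d a b = 2" using dist_le_2_if_P4_free[OF free ab(1,2)] dist_ge_2[OF ab] by simp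
  then obtain z where z: "E a z" "E z b" using dist_eq_2_common_neighbour ab by blast
  have univ: "E z w" if w: "w < n" "w \<noteq> z" for w
  proof (rule ccontr)
    assume zw: "\<not> E z w"
    have "z < n" using z adj_less by blast
    then have "d w z = 2"
      using dist_le_2_if_P4_free[OF free w(1)] dist_ge_2[of w z] w zw adj_sym by fastforce
    then obtain y where y: "E w y" "E y z" using dist_eq_2_common_neighbour w \<open>z < n\<close> by blast
    \<comment> \<open>One of a and b will do: y is not z, so it cannot be a further common neighbour
      of a and b.\<close>
    obtain c where c: "E z c" "c \<noteq> y" "\<not> E y c"
    proof (cases "y = a \<or> (y \<noteq> b \<and> \<not> E y b)")
      case True
      then show ?thesis using that[of b] z ab by blast
    next
      case False
      then have "\<not> E y a"
        using common_neighbour_unique[of a b y z] ab z y adj_sym adj_irrefl by metis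
      moreover have "y \<noteq> a" using False by blast
      ultimately show ?thesis using that[of a] z adj_sym by blast
    qed
    have "\<not> E w c" using common_neighbour_unique[of w z y c] c y w zw adj_sym by blast
    then have "induced_P4 w y z c" unfolding induced_P4_def using y c w zw adj_sym by blast
    then show False using free by blast
  qed
  \<comment> \<open>Otherwise v and z would be two common neighbours of the non-adjacent u and
    x.\<close>
  have "E u x" if "u \<noteq> z" "v \<noteq> z" "x \<noteq> z" "u \<noteq> x" "E u v" "E v x" for u v x
    using common_neighbour_unique[of u x v z] univ[of u] univ[of x] that adj_less adj_sym by blast
  then show ?thesis unfolding windmill_def using univ z adj_less by blast
qed

lemma P4_clique_with_pendants:
  assumes P: "induced_P4 p q r s"
  shows "\<exists>K. clique_with_pendants n E K"
proof -
  note P' = induced_P4_rev[OF P]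
  have e: "E p q" "E q r" "E r s" and ne: "p \<noteq> r" "q \<noteq> s" "\<not> E p r" "\<not> E q s" "\<not> E p s"
    using P by (auto simp: induced_P4_def)
  have lt: "p < n" "q < n" "r < n" "s < n" using e adj_less by blast+
  \<comment> \<open>The vertex q and all its neighbours except its pendant vertex p; by
    \<open>induced_P4_middle\<close> all of K other than r is adjacent to r as well. Two
    non-adjacent members would have q and r as common neighbours, so K is a clique.\<close>
  define K where "K = insert q {x. E q x \<and> x \<noteq> p}"
  have K: "K \<subseteq> {..<n}" using lt adj_less unfolding K_def by blast
  have Kr: "E r x" if "x \<in> K" "x \<noteq> r" for x
    using that e induced_P4_middle[OF P] adj_sym unfolding K_def by blast
  have Kq: "E q x" if "x \<in> K" "x \<noteq> q" for x using that unfolding K_def by blast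
  have clique: "E x y" if "x \<in> K" "y \<in> K" "x \<noteq> y" for x y
  proof (rule ccontr)
    assume "\<not> E x y"
    then have "q = r"
      using common_neighbour_unique[of x y q r] that Kq[of x] Kq[of y] Kr[of x] Kr[of y] adj_sym by blast
    then show False using e adj_irrefl by blast
  qed
  \<comment> \<open>Any edge leaving K begins an induced \<open>P4\<close> whose second and third
    vertices lie in K. So the two neighbourhood lemmas apply at every vertex of K, not only at q and
    r.\<close>
  have out: "\<exists>w\<in>K. w \<noteq> u \<and> (\<exists>t. induced_P4 v u w t \<and> t \<notin> K)" if u: "u \<in> K" and v: "v \<notin> K" "E u v" for u v
  proof -
    have pK: "p \<notin> K" "s \<notin> K" using e ne adj_irrefl unfolding K_def by blast+
    have rK: "r \<in> K" "q \<in> K" using e ne unfolding K_def by blast+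
    have qr: "q \<noteq> r" using e adj_irrefl by metis
    consider "u = q" | "u = r" | "u \<noteq> q" "u \<noteq> r" by blast
    then show ?thesis
    proof cases
      case 1
      then have "v = p" using v unfolding K_def by blast
      then show ?thesis using P 1 rK pK qr by (intro bexI[of _ r] conjI exI[of _ s]) auto
    next
      case 2
      have "v = s"
      proof (rule ccontr)
        assume "v \<noteq> s"
        moreover have "v \<noteq> q" using v rK by blast
        ultimately have "E q v" using induced_P4_middle[OF P'] v 2 by blast
        then have "v = p" using v unfolding K_def by blast
        then show False using v 2 ne adj_sym by blast
      qed
      then show ?thesis using P' 2 rK pK qr by (intro bexI[of _ q] conjI exI[of _ p]) auto
    next
      case 3
      have uq: "E q u" using Kq u 3 by blast
      have up: "\<not> E p u" using induced_P4_end[OF P] 3 by blast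
      then have vp: "v \<noteq> p" using v adj_sym by blast
      have "\<not> E q v" using v vp unfolding K_def by blast
      moreover have "\<not> E v p" using induced_P4_end[OF P, of v] v rK adj_sym by blast
      moreover have "v \<noteq> q" "u \<noteq> p" using v rK u pK by blast+
      ultimately have "induced_P4 v u q p" unfolding induced_P4_def
        using v uq up e adj_sym by blast
      then show ?thesis using rK pK 3 by (intro bexI[of _ q] conjI exI[of _ p]) auto
    qed
  qed
  have pend: "x = u" if "u \<in> K" "v \<notin> K" "E u v" "E v x" for u v x
    using out[OF that(1-3)] induced_P4_end that(4) by blast
  have uniq: "v = w" if A: "u \<in> K" "v \<notin> K" "w \<notin> K" "E u v" "E u w" for u v w
  proof (rule ccontr)
    assume "v \<noteq> w"
    obtain x t where x: "x \<in> K" "x \<noteq> u" "induced_P4 v u x t" using out[OF A(1,2,4)] by blast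
    then have "E x w" using induced_P4_middle[OF x(3)] A \<open>v \<noteq> w\<close> by blast
    then have "x = u" using pend[of u w x] A adj_sym by blast
    then show False using x by blast
  qed
  have cover: "\<exists>u\<in>K. E u v" if v: "v < n" "v \<notin> K" for v
  proof -
    let ?S = "K \<union> {v. \<exists>u\<in>K. E u v}"
    have "v \<in> ?S"
    proof (rule connected_closed_set[of q])
      fix u w assume u: "u \<in> ?S" "E u w"
      show "w \<in> ?S"
      proof (cases "u \<in> K")
        case True
        then show ?thesis using u by blast
      next
        case False
        then obtain x where "x \<in> K" "E x u" using u by blast
        then show ?thesis using pend[of x u w] False u by blast
      qed
    qed (use lt v in \<open>auto simp: K_def\<close>)
    then show ?thesis using v by blast
  qed
  have "\<exists>u\<in>K. \<forall>x. E v x \<longleftrightarrow> x = u" if v: "v \<in> {..<n} - K" for v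
  proof -
    obtain u where u: "u \<in> K" "E u v" using cover v by blast
    then have "E v x \<longleftrightarrow> x = u" for x using pend[of u v x] v adj_sym by blast
    then show ?thesis using u by blast
  qed
  moreover have "2 \<le> card ({..<n} - K)"
  proof -
    have "p \<noteq> s" using e ne adj_sym by blast
    then have "card {p, s} = 2" by simp
    moreover have "{p, s} \<subseteq> {..<n} - K" using lt e ne adj_irrefl unfolding K_def by blast
    ultimately show ?thesis by (metis card_mono finite_Diff finite_lessThan)
  qed
  ultimately have "clique_with_pendants n E K"
    unfolding clique_with_pendants_def using K clique uniq by blast
  then show ?thesis by blast
qed

text \<open>The split is by the existence of a missing edge and then of an induced
  \<open>P4\<close>.\<close>

theorem classification:
  obtains (complete) "\<And>u v. u < n \<Longrightarrow> v < n \<Longrightarrow> u \<noteq> v \<Longrightarrow> E u v"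
  | (windmill) z a b where "windmill n E z" "a < n" "b < n" "a \<noteq> b" "\<not> E a b"
  | (pendants) K where "clique_with_pendants n E K"
  using P4_free_windmill P4_clique_with_pendants by metis

end

section \<open>Determinants of rank-one updates\<close>

text \<open>The bordered matrix with rows (1, -v^T) and (y, I) is factored in two ways into block
  triangular matrices; comparing determinants gives the claim.\<close>

lemma det_one_plus_rank_one:
  fixes y v :: "nat \<Rightarrow> 'a :: field"
  shows "det (mat n n (\<lambda>(i,j). (if i = j then 1 else 0) + y i * v j)) = 1 + (\<Sum>i<n. v i * y i)"
proof -
  define R where "R = mat n n (\<lambda>(i,j). (if i = j then 1 else 0) + y i * v j)"
  define V where "V = mat 1 n (\<lambda>(i,j). - v j)"
  define Y where "Y = mat n 1 (\<lambda>(i,j). y i)"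
  define S where "S = mat 1 1 (\<lambda>_. 1 + (\<Sum>i<n. v i * y i))"
  note carr = R_def V_def Y_def S_def
  have c: "R \<in> carrier_mat n n" "V \<in> carrier_mat 1 n" "Y \<in> carrier_mat n 1" "S \<in> carrier_mat 1 1"
    by (auto simp: carr)
  have 1: "four_block_mat (1\<^sub>m 1) V Y (1\<^sub>m n) =
    four_block_mat (1\<^sub>m 1) (0\<^sub>m 1 n) Y (1\<^sub>m n) * four_block_mat (1\<^sub>m 1) V (0\<^sub>m n 1) R"
  proof -
    have "Y * V + R = 1\<^sub>m n" by (intro eq_matI) (auto simp: carr scalar_prod_def)
    then show ?thesis using c by (subst mult_four_block_mat[of _ 1 1 _ n _ n _ _ 1 _ n]) auto
  qed
  have 2: "four_block_mat (1\<^sub>m 1) V Y (1\<^sub>m n) =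
    four_block_mat S V (0\<^sub>m n 1) (1\<^sub>m n) * four_block_mat (1\<^sub>m 1) (0\<^sub>m 1 n) Y (1\<^sub>m n)"
  proof -
    have "S + V * Y = 1\<^sub>m 1"
      by (intro eq_matI) (auto simp: carr scalar_prod_def lessThan_atLeast0 sum_negf)
    then show ?thesis using c by (subst mult_four_block_mat[of _ 1 1 _ n _ n _ _ 1 _ n]) auto
  qed
  have dY: "det (four_block_mat (1\<^sub>m 1) (0\<^sub>m 1 n) Y (1\<^sub>m n)) = 1"
    using c by (subst det_four_block_mat_upper_right_zero[of _ 1 _ n]) auto
  have dR: "det (four_block_mat (1\<^sub>m 1) V (0\<^sub>m n 1) R) = det R"
    using c by (subst det_four_block_mat_lower_left_zero[of _ 1 _ n]) auto
  have dS: "det (four_block_mat S V (0\<^sub>m n 1) (1\<^sub>m n)) = det S"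
    using c by (subst det_four_block_mat_lower_left_zero[of _ 1 _ n]) auto
  note fc = four_block_carrier_mat[of _ 1 1 _ n n]
  have "det (four_block_mat (1\<^sub>m 1) V Y (1\<^sub>m n)) = det R"
    unfolding 1 using c dY dR by (subst det_mult[OF fc fc]) auto
  moreover have "det (four_block_mat (1\<^sub>m 1) V Y (1\<^sub>m n)) = det S"
    unfolding 2 using c dY dS by (subst det_mult[OF fc fc]) auto
  moreover have "det S = 1 + (\<Sum>i<n. v i * y i)"
    by (simp add: det_single S_def)
  ultimately show ?thesis by (simp add: R_def)
qed

text \<open>If B y = u then B + u v^T = B (I + y v^T). A solution y in place of an inverse of B
  keeps each application to the verification of one explicit vector.\<close>

lemma det_rank_one_update:
  fixes B :: "nat \<Rightarrow> nat \<Rightarrow> 'a :: field"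
  assumes "\<And>i. i < n \<Longrightarrow> (\<Sum>j<n. B i j * y j) = u i"
  shows "det (mat n n (\<lambda>(i,j). B i j + u i * v j)) =
    det (mat n n (\<lambda>(i,j). B i j)) * (1 + (\<Sum>i<n. v i * y i))"
proof -
  have "mat n n (\<lambda>(i,j). B i j + u i * v j) =
    mat n n (\<lambda>(i,j). B i j) * mat n n (\<lambda>(i,j). (if i = j then 1 else 0) + y i * v j)"
  proof (rule eq_matI)
    fix i j assume "i < dim_row (mat n n (\<lambda>(i,j). B i j) * mat n n (\<lambda>(i,j). (if i = j then 1 else 0) + y i * v j))"
      and "j < dim_col (mat n n (\<lambda>(i,j). B i j) * mat n n (\<lambda>(i,j). (if i = j then 1 else 0) + y i * v j))"
    then have ij: "i < n" "j < n" by auto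
    have "(mat n n (\<lambda>(i,j). B i j) * mat n n (\<lambda>(i,j). (if i = j then 1 else 0) + y i * v j)) $$ (i,j)
      = (\<Sum>k<n. B i k * ((if k = j then 1 else 0) + y k * v j))"
      using ij by (simp add: scalar_prod_def lessThan_atLeast0)
    also have "\<dots> = (\<Sum>k<n. (if k = j then B i j else 0) + B i k * y k * v j)"
      by (intro sum.cong) (auto simp: algebra_simps)
    also have "\<dots> = B i j + (\<Sum>k<n. B i k * y k) * v j"
      using ij by (simp add: sum.distrib sum_distrib_right)
    finally show "mat n n (\<lambda>(i,j). B i j + u i * v j) $$ (i,j) =
      (mat n n (\<lambda>(i,j). B i j) * mat n n (\<lambda>(i,j). (if i = j then 1 else 0) + y i * v j)) $$ (i,j)"
      using ij assms by simp
  qed auto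
  then show ?thesis by (simp add: det_mult[of _ n] det_one_plus_rank_one)
qed

lemma sum_indicator_subset:
  fixes f :: "nat \<Rightarrow> 'a :: comm_semiring_1"
  assumes "C \<subseteq> {..<n}"
  shows "(\<Sum>i<n. of_bool (i \<in> C) * f i) = (\<Sum>i\<in>C. f i)"
proof -
  have "(\<Sum>i<n. of_bool (i \<in> C) * f i) = (\<Sum>i\<in>C. of_bool (i \<in> C) * f i)"
    by (rule sum.mono_neutral_right) (use assms in auto)
  then show ?thesis by simp
qed

lemma sum_delta_mult:
  fixes f :: "nat \<Rightarrow> 'a :: comm_semiring_1"
  assumes "i < n"
  shows "(\<Sum>j<n. c * of_bool (i = j) * f j) = c * f i"
proof -
  have "(\<Sum>j<n. c * of_bool (i = j) * f j) = (\<Sum>j<n. if i = j then c * f i else 0)"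
    by (intro sum.cong) auto
  then show ?thesis using assms by simp
qed

text \<open>Blocks are added one at a time. By disjointness the earlier blocks annihilate the
  indicator of the new block C, so the indicator divided by x solves the required system.\<close>

lemma det_scalar_plus_blocks:
  fixes x :: real
  assumes "finite \<C>" "\<And>C. C \<in> \<C> \<Longrightarrow> C \<subseteq> {..<n}" "disjoint \<C>" "x > 0"
  shows "det (mat n n (\<lambda>(i,j). x * of_bool (i = j) + (\<Sum>C\<in>\<C>. of_bool (i \<in> C) * of_bool (j \<in> C)))) =
    x ^ n * (\<Prod>C\<in>\<C>. 1 + card C / x)"
  using assms(1-3)
proof (induction \<C> rule: finite_induct)
  case empty
  have "mat n n (\<lambda>(i,j). x * of_bool (i = j)) = x \<cdot>\<^sub>m 1\<^sub>m n" by (intro eq_matI) auto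
  then show ?case by (simp add: det_smult)
next
  case (insert C \<C>)
  have C: "C \<subseteq> {..<n}" using insert.prems by blast
  have disj: "j \<notin> D" if "D \<in> \<C>" "j \<in> C" for D j
  proof -
    have "C \<inter> D = {}"
      by (rule disjointD[OF insert.prems(2)]) (use that insert.hyps in auto)
    then show ?thesis using that by blast
  qed
  define B where "B i j = x * of_bool (i = j) + (\<Sum>C\<in>\<C>. of_bool (i \<in> C) * of_bool (j \<in> C))" for i j :: nat
  have By: "(\<Sum>j<n. B i j * (of_bool (j \<in> C) / x)) = of_bool (i \<in> C)" if i: "i < n" for i
  proof -
    have "(\<Sum>j<n. B i j * (of_bool (j \<in> C) / x)) =
      (\<Sum>j<n. x * of_bool (i = j) * (of_bool (j \<in> C) / x)
        + (\<Sum>D\<in>\<C>. of_bool (i \<in> D) * of_bool (j \<in> D) * (of_bool (j \<in> C) / x)))"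
      by (simp only: B_def distrib_right sum_distrib_right)
    also have "\<dots> = (\<Sum>j<n. x * of_bool (i = j) * (of_bool (j \<in> C) / x))"
      using disj by (intro sum.cong refl) (auto intro!: sum.neutral)
    finally show ?thesis unfolding sum_delta_mult[OF i] using assms(4) by simp
  qed
  have "(\<lambda>(i,j). x * of_bool (i = j) + (\<Sum>D\<in>insert C \<C>. of_bool (i \<in> D) * of_bool (j \<in> D))) =
    (\<lambda>(i,j). B i j + of_bool (i \<in> C) * of_bool (j \<in> C))"
    using insert.hyps by (auto simp: B_def fun_eq_iff)
  then have "det (mat n n (\<lambda>(i,j). x * of_bool (i = j) + (\<Sum>D\<in>insert C \<C>. of_bool (i \<in> D) * of_bool (j \<in> D)))) =
    det (mat n n (\<lambda>(i,j). B i j)) * (1 + (\<Sum>i<n. of_bool (i \<in> C) * (of_bool (i \<in> C) / x)))"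
    using det_rank_one_update[where B = B and u = "\<lambda>i. of_bool (i \<in> C)" and v = "\<lambda>i. of_bool (i \<in> C)"
        and y = "\<lambda>i. of_bool (i \<in> C) / x" and n = n] By by simp
  also have "det (mat n n (\<lambda>(i,j). B i j)) = x ^ n * (\<Prod>C\<in>\<C>. 1 + card C / x)"
    unfolding B_def using insert.IH insert.prems by (auto simp: disjoint_def pairwise_insert)
  also have "(\<Sum>i<n. of_bool (i \<in> C) * (of_bool (i \<in> C) / x)) = card C / x"
    using sum_indicator_subset[OF C, of "\<lambda>i. of_bool (i \<in> C) / x"] by simp
  finally show ?case using insert.hyps by (simp add: mult_ac)
qed

section \<open>Windmills\<close>

text \<open>Evaluation at a number moves the determinant from polynomials to a field, where rank-one
  updates with explicit denominators are available.\<close>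

lemma poly_char_poly_det:
  fixes A :: "'a :: field mat"
  assumes A: "A \<in> carrier_mat n n"
  shows "poly (char_poly A) x = det (mat n n (\<lambda>(i,j). x * of_bool (i = j) - A $$ (i,j)))"
proof -
  have hom: "comm_ring_hom (\<lambda>p :: 'a poly. poly p x)" by unfold_locales auto
  have "map_mat (\<lambda>p. poly p x) (char_poly_matrix A) = mat n n (\<lambda>(i,j). x * of_bool (i = j) - A $$ (i,j))"
    using A by (intro eq_matI) (auto simp: char_poly_matrix_def)
  then show ?thesis unfolding char_poly_def using comm_ring_hom.hom_det[OF hom] by metis
qed

text \<open>For P the product of the X + 1 + n_i, the bracket equals P times the sum of n_i / (X + 1
  + n_i). The definition is thus the secular equation X = (1 + 2 X) times that sum, cleared of
  denominators and written linearly in P.\<close>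

definition windmill_poly :: "nat \<Rightarrow> real poly \<Rightarrow> real poly" where
  "windmill_poly k P = [:0, 1:] * P - [:1, 2:] * ([:real k:] * P - [:1, 1:] * pderiv P)"

text \<open>A nonzero \<open>P\<close> of degree \<open>d\<close> with leading coefficient \<open>c\<close> is mapped to a polynomial with leading
  term \<open>c (1 - 2 k + 2 d) X^(d+1)\<close>, and \<open>1 - 2 k + 2 d\<close> is odd.\<close>

lemma windmill_poly_inject:
  assumes eq: "windmill_poly k P = windmill_poly k Q"
  shows "P = Q"
proof (rule ccontr)
  assume "P \<noteq> Q"
  define R where "R = P - Q"
  have R: "R \<noteq> 0" using \<open>P \<noteq> Q\<close> by (simp add: R_def)
  define m where "m = degree R"
  have "x * (p - q) - y * (k * (p - q) - w * (p' - q')) =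
      (x * p - y * (k * p - w * p')) - (x * q - y * (k * q - w * q'))"
    for x y k w p q p' q' :: "real poly" by (simp add: algebra_simps)
  then have 0: "windmill_poly k R = 0"
    using eq unfolding windmill_poly_def R_def pderiv_diff by (simp only: diff_self)
  have c0: "coeff R (Suc m) = 0" "coeff R (Suc (Suc m)) = 0" by (auto simp: m_def intro: coeff_eq_0)
  have cm: "coeff R m \<noteq> 0" using R by (simp add: m_def)
  have "coeff (windmill_poly k R) (Suc m) = coeff R m - 2 * (real k * coeff R m - real m * coeff R m)"
    using c0 unfolding windmill_poly_def by (cases m) (simp_all add: coeff_pderiv)
  then have "coeff R m * (1 - 2 * real k + 2 * real m) = 0" using 0 by (simp add: algebra_simps)
  then have "1 + 2 * real m = 2 * real k" using cm by simp
  then have "1 + 2 * m = 2 * k" by linarith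
  then show False by presburger
qed

locale windmill_graph = conn_graph +
  fixes z assumes wm: "windmill n E z"
begin

definition blade :: "nat \<Rightarrow> nat set" where
  "blade u = {v. v < n \<and> v \<noteq> z \<and> (v = u \<or> E u v)}"

definition blades :: "nat set set" where
  "blades = blade ` ({..<n} - {z})"

lemma hub: "z < n" "\<And>v. v < n \<Longrightarrow> v \<noteq> z \<Longrightarrow> E z v"
  using wm by (auto simp: windmill_def)

lemma adj_trans: "u \<noteq> z \<Longrightarrow> v \<noteq> z \<Longrightarrow> x \<noteq> z \<Longrightarrow> u \<noteq> x \<Longrightarrow> E u v \<Longrightarrow> E v x \<Longrightarrow> E u x"
  using wm unfolding windmill_def by blast

lemma blade_eq:
  assumes "u < n" "u \<noteq> z" "v \<in> blade u"
  shows "blade v = blade u"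
proof -
  have v: "v < n" "v \<noteq> z" "v = u \<or> E u v" using assms by (auto simp: blade_def)
  have "w = v \<or> E v w \<longleftrightarrow> w = u \<or> E u w" if "w \<noteq> z" for w
    using adj_trans[of v u w] adj_trans[of u v w] v assms(2) that adj_sym by blast
  then show ?thesis by (auto simp: blade_def)
qed

lemma blades_disjoint: "disjoint blades"
proof (unfold disjoint_def pairwise_def, intro ballI impI)
  fix C D assume "C \<in> blades" "D \<in> blades" "C \<noteq> D"
  then obtain u v where uv: "u < n" "u \<noteq> z" "C = blade u" "v < n" "v \<noteq> z" "D = blade v"
    by (auto simp: blades_def)
  show "disjnt C D"
  proof (rule ccontr)
    assume "\<not> disjnt C D"
    then obtain w where "w \<in> C" "w \<in> D" by (auto simp: disjnt_def)
    then have "blade w = C" "blade w = D" using blade_eq[of u w] blade_eq[of v w] uv by blast+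
    then show False using \<open>C \<noteq> D\<close> by simp
  qed
qed

lemma blades_Union: "\<Union>blades = {..<n} - {z}"
  by (auto simp: blades_def blade_def)

lemma finite_blades: "finite blades" by (simp add: blades_def)

lemma blades_subset: "C \<in> blades \<Longrightarrow> C \<subseteq> {..<n}"
  using blades_Union by blast

lemma finite_blade: "C \<in> blades \<Longrightarrow> finite C"
  using blades_subset finite_subset by blast

lemma blades_nonempty: "C \<in> blades \<Longrightarrow> C \<noteq> {}"
  by (auto simp: blades_def blade_def)

lemma card_blade_pos: "C \<in> blades \<Longrightarrow> 0 < card C"
  using finite_blade blades_nonempty by (simp add: card_gt_0_iff)

lemma in_blades_iff:
  assumes "u < n" "u \<noteq> z"
  shows "C \<in> blades \<and> u \<in> C \<longleftrightarrow> C = blade u"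
proof
  assume C: "C \<in> blades \<and> u \<in> C"
  then obtain v where "v < n" "v \<noteq> z" "C = blade v" by (auto simp: blades_def)
  then show "C = blade u" using blade_eq C by blast
qed (use assms in \<open>auto simp: blades_def blade_def\<close>)

lemma sum_over_blades: "(\<Sum>u\<in>{..<n} - {z}. f u) = (\<Sum>C\<in>blades. \<Sum>u\<in>C. f u)"
  unfolding blades_Union[symmetric]
  using finite_blade blades_disjoint by (subst sum.Union_disjoint_sets) auto

lemma dist_windmill:
  assumes "u < n" "v < n"
  shows "d u v = (if u = v then 0 else if u = z \<or> v = z \<or> v \<in> blade u then 1 else 2)"
proof -
  consider "u = v" | "u \<noteq> v" "u = z \<or> v = z \<or> v \<in> blade u"
    | "u \<noteq> v" "u \<noteq> z" "v \<noteq> z" "v \<notin> blade u" by blast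
  then show ?thesis
  proof cases
    case 2
    then have "E u v" using hub(2) assms adj_sym by (auto simp: blade_def)
    then show ?thesis using 2 dist_adj by simp
  next
    case 3
    then have "\<not> E u v" using assms by (auto simp: blade_def)
    then have "d u v = 2" using dist_eq_2[of u v z] 3 hub(2) assms adj_sym by blast
    then show ?thesis using 3 by simp
  qed (use assms in auto)
qed

text \<open>The factor \<open>of_bool (i \<noteq> z)\<close> matters: \<open>blade z\<close>
  consists of all vertices but the hub and must not count as the blade of z.\<close>

lemma sum_blades_indicator:
  assumes "i < n" "j < n"
  shows "(\<Sum>C\<in>blades. of_bool (i \<in> C) * of_bool (j \<in> C) * (f C :: real)) =
    of_bool (i \<noteq> z) * of_bool (j \<in> blade i) * f (blade i)"
proof (cases "i = z")
  case True
  then have "i \<notin> C" if "C \<in> blades" for C using that blades_Union by blast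
  then show ?thesis using True by simp
next
  case False
  have "(\<Sum>C\<in>blades. of_bool (i \<in> C) * of_bool (j \<in> C) * f C) =
    (\<Sum>C\<in>{blade i}. of_bool (i \<in> C) * of_bool (j \<in> C) * f C)"
    using in_blades_iff[OF assms(1) False] finite_blades by (intro sum.mono_neutral_right) auto
  then show ?thesis using False assms by (auto simp: blade_def)
qed

text \<open>With \<open>e\<close> the unit vector at the hub and \<open>w = 1 - e/2\<close>, the matrix \<open>x I - D\<close> is
  \<open>(x + 1) I\<close> plus one all-ones block per blade, minus \<open>e e^T / 2\<close>, minus \<open>2 w w^T\<close>, that is,
  a scalar matrix after a sequence of rank-one updates.\<close>

lemma char_poly_windmill_pos:
  fixes x :: real
  assumes x: "x > 0"
  shows "poly (char_poly (dist_matrix n E)) x * (x + 1) ^ card blades =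
    (x + 1) ^ (n - 1) * (\<Prod>C\<in>blades. x + 1 + card C) * (x - (1 + 2 * x) * (\<Sum>C\<in>blades. card C / (x + 1 + card C)))"
proof -
  define B where "B i j = (x + 1) * of_bool (i = j) + (\<Sum>C\<in>blades. of_bool (i \<in> C) * of_bool (j \<in> C))" for i j
  define B' where "B' i j = B i j + (- 1/2 * of_bool (i = z)) * of_bool (j = z)" for i j
  define w :: "nat \<Rightarrow> real" where "w i = (if i = z then 1/2 else 1)" for i
  \<comment> \<open>The solution of B' y = w, constant on blades: on a blade of size m the row reads
    (x + 1 + m) y = 1, at the hub (x + 1/2) y = 1/2.\<close>
  define y where "y i = (if i = z then 1/2 / (x + 1/2) else 1 / (x + 1 + card (blade i)))" for i
  have zb: "z \<notin> blade i" for i by (simp add: blade_def)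
  have Bij: "B i j = (x + 1) * of_bool (i = j) + of_bool (i \<noteq> z) * of_bool (j \<in> blade i)" if "i < n" "j < n" for i j
    using sum_blades_indicator[OF that, of "\<lambda>_. 1"] unfolding B_def by (simp only: mult_1_right)
  have Bf: "(\<Sum>j<n. B i j * f j) = (x + 1) * f i + of_bool (i \<noteq> z) * (\<Sum>j\<in>blade i. f j)" if i: "i < n" for i f
  proof -
    have sub: "blade i \<subseteq> {..<n}" by (auto simp: blade_def)
    have "(\<Sum>j<n. B i j * f j) = (\<Sum>j<n. (x + 1) * of_bool (i = j) * f j + of_bool (i \<noteq> z) * (of_bool (j \<in> blade i) * f j))"
      using i by (intro sum.cong refl) (simp add: Bij distrib_right)
    also have "\<dots> = (x + 1) * f i + of_bool (i \<noteq> z) * (\<Sum>j\<in>blade i. f j)"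
      unfolding sum.distrib sum_delta_mult[OF i] sum_distrib_left[symmetric] sum_indicator_subset[OF sub] ..
    finally show ?thesis .
  qed
  have detB: "det (mat n n (\<lambda>(i,j). B i j)) = (x + 1) ^ n * (\<Prod>C\<in>blades. 1 + card C / (x + 1))"
    unfolding B_def using finite_blades blades_subset blades_disjoint x by (intro det_scalar_plus_blocks) auto
  have detB': "det (mat n n (\<lambda>(i,j). B' i j)) = det (mat n n (\<lambda>(i,j). B i j)) * (1 - 1/2 / (x + 1))"
  proof -
    have "(\<Sum>j<n. B i j * (- 1/2 * of_bool (j = z) / (x + 1))) = - 1/2 * of_bool (i = z)" if "i < n" for i
    proof -
      have "(\<Sum>j\<in>blade i. - 1/2 * of_bool (j = z) / (x + 1)) = 0"
        using zb by (intro sum.neutral) auto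
      then show ?thesis using that x by (simp only: Bf) simp
    qed
    then have "det (mat n n (\<lambda>(i,j). B' i j)) =
        det (mat n n (\<lambda>(i,j). B i j)) * (1 + (\<Sum>i<n. of_bool (i = z) * (- 1/2 * of_bool (i = z) / (x + 1))))"
      unfolding B'_def by (rule det_rank_one_update)
    also have "(\<Sum>i<n. of_bool (i = z) * (- 1/2 * of_bool (i = z) / (x + 1))) = (\<Sum>i<n. if i = z then - 1/2 / (x + 1) else 0)"
      by (intro sum.cong) auto
    finally show ?thesis using hub(1) by simp
  qed
  have B'y: "(\<Sum>j<n. B' i j * y j) = w i" if i: "i < n" for i
  proof -
    have "(\<Sum>j<n. B' i j * y j) = (\<Sum>j<n. B i j * y j + (if j = z then - 1/2 * of_bool (i = z) * y z else 0))"
      by (intro sum.cong refl) (auto simp: B'_def algebra_simps)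
    also have "\<dots> = (x + 1) * y i + of_bool (i \<noteq> z) * (\<Sum>j\<in>blade i. y j) - 1/2 * of_bool (i = z) * y z"
      using hub(1) by (simp add: sum.distrib Bf[OF i])
    also have "\<dots> = w i"
    proof (cases "i = z")
      case True
      have "(x + 1) * y z - 1/2 * y z = (x + 1/2) * y z" by (simp add: algebra_simps)
      also have "\<dots> = 1/2" using x by (simp add: y_def)
      finally show ?thesis using True by (simp add: w_def)
    next
      case False
      define D where "D = x + 1 + card (blade i)"
      have "D \<noteq> 0" using x unfolding D_def by linarith
      have yi: "y i = 1 / D" using False by (simp add: y_def D_def)
      have "(\<Sum>j\<in>blade i. y j) = (\<Sum>j\<in>blade i. 1 / D)"
        using zb blade_eq[OF i False] by (intro sum.cong refl) (auto simp: y_def D_def)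
      also have "\<dots> = card (blade i) * (1 / D)" by simp
      finally have "(x + 1) * y i + (\<Sum>j\<in>blade i. y j) = D * (1 / D)"
        unfolding yi D_def by (simp only: distrib_right)
      then show ?thesis using False \<open>D \<noteq> 0\<close> by (simp add: w_def)
    qed
    finally show ?thesis .
  qed
  have sumwy: "(\<Sum>i<n. - 2 * w i * y i) = - 1/2 / (x + 1/2) - 2 * (\<Sum>C\<in>blades. card C / (x + 1 + card C))"
  proof -
    have "(\<Sum>i<n. - 2 * w i * y i) = - 2 * w z * y z + (\<Sum>i\<in>{..<n} - {z}. - 2 * w i * y i)"
      using hub(1) by (subst sum.remove[of _ z]) auto
    also have "(\<Sum>i\<in>{..<n} - {z}. - 2 * w i * y i) = (\<Sum>C\<in>blades. \<Sum>i\<in>C. - 2 * w i * y i)"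
      by (rule sum_over_blades)
    also have "\<dots> = (\<Sum>C\<in>blades. - 2 * (card C / (x + 1 + card C)))"
    proof (rule sum.cong[OF refl])
      fix C assume C: "C \<in> blades"
      have "(\<Sum>i\<in>C. - 2 * w i * y i) = (\<Sum>i\<in>C. - 2 / (x + 1 + card C))"
      proof (rule sum.cong[OF refl])
        fix i assume i: "i \<in> C"
        then have "i < n" "i \<noteq> z" using C blades_Union by blast+
        moreover from this have "blade i = C" using in_blades_iff[of i C] C i by simp
        ultimately show "- 2 * w i * y i = - 2 / (x + 1 + card C)" by (simp add: w_def y_def)
      qed
      then show "(\<Sum>i\<in>C. - 2 * w i * y i) = - 2 * (card C / (x + 1 + card C))" by simp
    qed
    finally have "(\<Sum>i<n. - 2 * w i * y i) = - 2 * w z * y z - 2 * (\<Sum>C\<in>blades. card C / (x + 1 + card C))"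
      by (simp only: sum_distrib_left[symmetric])
    moreover have "- 2 * w z * y z = - 1/2 / (x + 1/2)" by (simp add: w_def y_def)
    ultimately show ?thesis by simp
  qed
  have "poly (char_poly (dist_matrix n E)) x = det (mat n n (\<lambda>(i,j). B' i j + w i * (- 2 * w j)))"
  proof -
    have "x * of_bool (i = j) - dist_matrix n E $$ (i,j) = B' i j + w i * (- 2 * w j)" if ij: "i < n" "j < n" for i j
    proof -
      have "i \<in> blade i" if "i \<noteq> z" using that ij by (simp add: blade_def)
      moreover have "dist_matrix n E $$ (i,j) = real (d i j)" using ij by (simp add: dist_matrix_def)
      ultimately show ?thesis unfolding dist_windmill[OF ij] B'_def Bij[OF ij] w_def
        using zb[of i] by (cases "i = z"; cases "j = z"; cases "i = j"; cases "j \<in> blade i") simp_all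
    qed
    then have "mat n n (\<lambda>(i,j). x * of_bool (i = j) - dist_matrix n E $$ (i,j)) = mat n n (\<lambda>(i,j). B' i j + w i * (- 2 * w j))"
      by (intro eq_matI) auto
    then show ?thesis using poly_char_poly_det[OF dist_matrix_carrier] by simp
  qed
  also have "\<dots> = det (mat n n (\<lambda>(i,j). B' i j)) * (1 + (\<Sum>i<n. - 2 * w i * y i))"
    using B'y by (rule det_rank_one_update)
  also have "\<dots> = (x + 1) ^ n * (\<Prod>C\<in>blades. 1 + card C / (x + 1)) * (1 - 1/2 / (x + 1)) *
      (1 - 1/2 / (x + 1/2) - 2 * (\<Sum>C\<in>blades. card C / (x + 1 + card C)))"
    unfolding detB' detB sumwy by simp
  finally have chi: "poly (char_poly (dist_matrix n E)) x = \<dots>" .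
  define s where "s = (\<Sum>C\<in>blades. card C / (x + 1 + card C))"
  have prod: "(\<Prod>C\<in>blades. 1 + card C / (x + 1)) * (x + 1) ^ card blades = (\<Prod>C\<in>blades. x + 1 + card C)"
  proof -
    have "(\<Prod>C\<in>blades. 1 + card C / (x + 1)) * (x + 1) ^ card blades = (\<Prod>C\<in>blades. (1 + card C / (x + 1)) * (x + 1))"
      by (simp add: prod.distrib)
    also have "\<dots> = (\<Prod>C\<in>blades. x + 1 + card C)"
      using x by (intro prod.cong refl) (simp add: field_simps)
    finally show ?thesis .
  qed
  have eq: "(x + 1) ^ n * (1 - 1/2 / (x + 1)) * (1 - 1/2 / (x + 1/2) - 2 * s) = (x + 1) ^ (n - 1) * (x - (1 + 2 * x) * s)"
  proof -
    have "(x + 1) ^ n = (x + 1) ^ (n - 1) * (x + 1)" using n_pos by (metis Suc_pred' power_Suc2)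
    moreover have "(x + 1) * (1 - 1/2 / (x + 1)) = x + 1/2" using x by (simp add: field_simps)
    moreover have "(x + 1/2) * (1 - 1/2 / (x + 1/2) - 2 * s) = x - (1 + 2 * x) * s" using x by (simp add: field_simps)
    ultimately show ?thesis by (metis mult.assoc)
  qed
  have "(x + 1) ^ n * p * (1 - 1/2 / (x + 1)) * (1 - 1/2 / (x + 1/2) - 2 * s) * t =
    (x + 1) ^ (n - 1) * (p * t) * (x - (1 + 2 * x) * s)" for p t
  proof -
    have "(x + 1) ^ n * p * (1 - 1/2 / (x + 1)) * (1 - 1/2 / (x + 1/2) - 2 * s) * t =
      ((x + 1) ^ n * (1 - 1/2 / (x + 1)) * (1 - 1/2 / (x + 1/2) - 2 * s)) * (p * t)"
      by (simp only: mult_ac)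
    then show ?thesis unfolding eq by (simp only: mult_ac)
  qed
  then show ?thesis unfolding chi s_def[symmetric] prod[symmetric] .
qed

definition blade_poly :: "real poly" where
  "blade_poly = (\<Prod>C\<in>blades. [:1 + real (card C), 1:])"

lemma poly_blade_poly:
  fixes x :: real
  shows "poly blade_poly x = (\<Prod>C\<in>blades. x + 1 + card C)"
  by (simp add: blade_poly_def poly_prod algebra_simps)

lemma poly_windmill_poly:
  fixes x :: real
  assumes "\<And>C. C \<in> blades \<Longrightarrow> x + 1 + card C \<noteq> 0"
  shows "poly (windmill_poly (card blades) blade_poly) x =
    poly blade_poly x * (x - (1 + 2 * x) * (\<Sum>C\<in>blades. card C / (x + 1 + card C)))"
proof -
  let ?P = "poly blade_poly x"
  have "poly (pderiv blade_poly) x = (\<Sum>C\<in>blades. \<Prod>D\<in>blades - {C}. x + 1 + card D)"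
    by (simp add: blade_poly_def pderiv_prod pderiv_pCons poly_sum poly_prod algebra_simps)
  also have "\<dots> = (\<Sum>C\<in>blades. ?P * (1 / (x + 1 + card C)))"
  proof (rule sum.cong[OF refl])
    fix C assume C: "C \<in> blades"
    have "?P = (x + 1 + card C) * (\<Prod>D\<in>blades - {C}. x + 1 + card D)"
      unfolding poly_blade_poly using C finite_blades by (rule prod.remove[rotated])
    then show "(\<Prod>D\<in>blades - {C}. x + 1 + card D) = ?P * (1 / (x + 1 + card C))"
      using assms[OF C] by simp
  qed
  finally have der: "poly (pderiv blade_poly) x = ?P * (\<Sum>C\<in>blades. 1 / (x + 1 + card C))"
    by (simp add: sum_distrib_left)
  have k: "real (card blades) - (x + 1) * (\<Sum>C\<in>blades. 1 / (x + 1 + card C)) = (\<Sum>C\<in>blades. card C / (x + 1 + card C))"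
  proof -
    have "real (card blades) - (x + 1) * (\<Sum>C\<in>blades. 1 / (x + 1 + card C)) = (\<Sum>C\<in>blades. 1 - (x + 1) * (1 / (x + 1 + card C)))"
      by (simp add: sum_subtractf sum_distrib_left)
    also have "\<dots> = (\<Sum>C\<in>blades. card C / (x + 1 + card C))"
      using assms by (intro sum.cong refl) (simp add: field_simps)
    finally show ?thesis .
  qed
  have "poly (windmill_poly (card blades) blade_poly) x =
    ?P * (x - (1 + 2 * x) * (real (card blades) - (x + 1) * (\<Sum>C\<in>blades. 1 / (x + 1 + card C))))"
    unfolding windmill_poly_def by (simp add: der algebra_simps)
  then show ?thesis unfolding k .
qed

text \<open>Both sides agree at all x > 0, where no denominator vanishes, hence as polynomials. The
  power of X + 1 stands on the left so that no difference of exponents is formed.\<close>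

lemma char_poly_windmill:
  "char_poly (dist_matrix n E) * [:1, 1:] ^ card blades =
    [:1, 1:] ^ (n - 1) * windmill_poly (card blades) blade_poly" (is "?L = ?R")
proof -
  have "poly (?L - ?R) x = 0" if "x > 0" for x :: real
  proof -
    have "x + 1 + card C \<noteq> 0" for C :: "nat set" using that by linarith
    then have "poly (windmill_poly (card blades) blade_poly) x =
        poly blade_poly x * (x - (1 + 2 * x) * (\<Sum>C\<in>blades. card C / (x + 1 + card C)))"
      using poly_windmill_poly by blast
    moreover have "poly [:1, 1:] x = x + 1" by simp
    ultimately show ?thesis
      using char_poly_windmill_pos[OF that]
      by (simp only: poly_diff poly_mult poly_power poly_blade_poly)
  qed
  then have "{0<..} \<subseteq> {x. poly (?L - ?R) x = 0}" by blast
  then have "infinite {x. poly (?L - ?R) x = 0}"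
    using infinite_Ioi[of "0 :: real"] finite_subset by blast
  then have "?L - ?R = 0" using poly_roots_finite by blast
  then show ?thesis by simp
qed

end

section \<open>Blade sizes of windmills with conjugate eigenvalues\<close>

text \<open>In the equations below the sizes 1, 2 and 3 contribute values of varying sign and are
  counted one by one; from 4 on uniform estimates suffice.\<close>

lemma sum_split_sizes:
  fixes h :: "nat \<Rightarrow> real" and g :: "'a \<Rightarrow> nat"
  assumes "finite S" "\<And>C. C \<in> S \<Longrightarrow> 0 < g C"
  shows "(\<Sum>C\<in>S. h (g C)) = card {C\<in>S. g C = 1} * h 1 + card {C\<in>S. g C = 2} * h 2
    + card {C\<in>S. g C = 3} * h 3 + (\<Sum>C\<in>{C\<in>S. 4 \<le> g C}. h (g C))"
  using assms
proof (induction S rule: finite_induct)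
  case (insert C S)
  have ins: "{D\<in>insert C S. P (g D)} = (if P (g C) then insert C {D\<in>S. P (g D)} else {D\<in>S. P (g D)})" for P
    by auto
  have "g C = 1 \<or> g C = 2 \<or> g C = 3 \<or> 4 \<le> g C" using insert.prems[of C] by auto
  then show ?case
    using insert.hyps insert.IH insert.prems
    unfolding ins[of "\<lambda>m. m = 1"] ins[of "\<lambda>m. m = 2"] ins[of "\<lambda>m. m = 3"] ins[of "\<lambda>m. 4 \<le> m"]
    by (elim disjE) (auto simp: algebra_simps)
qed simp

text \<open>Irrationality of sqrt 2 in the form needed here: the denominators m - 1 + sqrt 2 and m -
  1 - sqrt 2 never vanish.\<close>

lemma pred_square_neq_2: "(real m - 1)\<^sup>2 \<noteq> 2"
proof
  assume "(real m - 1)\<^sup>2 = 2"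
  then have "real_of_int ((int m - 1)\<^sup>2) = 2" by simp
  then have e: "(int m - 1)\<^sup>2 = 2" by linarith
  have "\<bar>int m - 1\<bar> < 2"
  proof (rule ccontr)
    assume "\<not> ?thesis"
    then have "\<bar>int m - 1\<bar>\<^sup>2 \<ge> 2\<^sup>2" by (intro power_mono) auto
    then show False using e by simp
  qed
  then have "int m - 1 \<in> {-1, 0, 1}" by auto
  then show False using e by (auto simp: power2_eq_square)
qed

text \<open>Adding and subtracting the two equations splits them into rational equations for the
  sizes; only the sizes 2, 2, 3, 3 solve these.\<close>

lemma conjugate_size_equations:
  fixes g :: "'a \<Rightarrow> nat"
  assumes fin: "finite S" and pos: "\<And>C. C \<in> S \<Longrightarrow> 0 < g C"
    and plus: "(\<Sum>C\<in>S. real (g C) / (real (g C) - 1 + sqrt 2)) = 2 + sqrt 2"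
    and minus: "(\<Sum>C\<in>S. real (g C) / (real (g C) - 1 - sqrt 2)) = 2 - sqrt 2"
  shows "(\<Sum>C\<in>S. g C) = 10" "(\<Sum>C\<in>S. (g C)\<^sup>2) = 26"
proof -
  \<comment> \<open>\<open>q m\<close> is the norm of m - 1 + sqrt 2; \<open>f1\<close> and
    \<open>f2\<close> give the rational and the irrational part of each summand.\<close>
  define q where "q m = (real m - 1)\<^sup>2 - 2" for m
  define f1 where "f1 m = real m * (real m - 1) / q m" for m
  define f2 where "f2 m = real m / q m" for m
  have sq: "sqrt 2 * sqrt 2 = (2::real)" by simp
  have q0: "q m \<noteq> 0" for m using pred_square_neq_2[of m] by (simp add: q_def)
  have fac: "q m = (real m - 1 + sqrt 2) * (real m - 1 - sqrt 2)" for m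
    using sq by (simp add: q_def power2_eq_square algebra_simps)
  have nz: "real m - 1 + sqrt 2 \<noteq> 0" "real m - 1 - sqrt 2 \<noteq> 0" for m
    using q0[of m] unfolding fac by auto
  have tp: "real m / (real m - 1 + sqrt 2) = f1 m - sqrt 2 * f2 m" for m
    using nz[of m] unfolding f1_def f2_def fac by (simp add: divide_simps) (simp add: algebra_simps)
  have tm: "real m / (real m - 1 - sqrt 2) = f1 m + sqrt 2 * f2 m" for m
    using nz[of m] unfolding f1_def f2_def fac by (simp add: divide_simps) (simp add: algebra_simps)
  define F where "F = (\<Sum>C\<in>S. f1 (g C))"
  define G where "G = (\<Sum>C\<in>S. f2 (g C))"
  have "F - sqrt 2 * G = 2 + sqrt 2" using plus unfolding tp F_def G_def by (simp add: sum_subtractf sum_distrib_left)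
  moreover have "F + sqrt 2 * G = 2 - sqrt 2" using minus unfolding tm F_def G_def by (simp add: sum.distrib sum_distrib_left)
  ultimately have F: "F = 2" and "sqrt 2 * G = sqrt 2 * (- 1)" by linarith+
  then have G: "G = - 1" using mult_left_cancel[of "sqrt 2" G "- 1"] by (metis real_sqrt_eq_zero_cancel_iff zero_neq_numeral)
  have s1: "sqrt 2 > 1" "sqrt 2 < 3/2" by (simp, rule real_less_lsqrt) (auto simp: power2_eq_square)
  \<comment> \<open>Each summand of \<open>plus\<close> lies between (sqrt 2)/2 and 1, so the number
    of sizes lies between 2 + sqrt 2 > 3 and 2 + 2 sqrt 2 < 5.\<close>
  have card4: "card S = 4"
  proof -
    have tl: "sqrt 2 / 2 \<le> real (g C) / (real (g C) - 1 + sqrt 2)"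
      and tu: "real (g C) / (real (g C) - 1 + sqrt 2) \<le> 1" if "C \<in> S" for C
    proof -
      have m: "real (g C) \<ge> 1" using pos[OF that] by simp
      then have p: "real (g C) - 1 + sqrt 2 > 0" using s1 by linarith
      show "real (g C) / (real (g C) - 1 + sqrt 2) \<le> 1"
        unfolding divide_le_eq_1_pos[OF p] using s1 by linarith
      have "(real (g C) - 1) * (sqrt 2 / 2) \<le> (real (g C) - 1) * 1" using m s1 by (intro mult_left_mono) auto
      moreover have e: "sqrt 2 / 2 * (real (g C) - 1 + sqrt 2) = (real (g C) - 1) * (sqrt 2 / 2) + 1"
        using sq by (simp add: field_simps)
      ultimately have "sqrt 2 / 2 * (real (g C) - 1 + sqrt 2) \<le> (real (g C) - 1) * 1 + 1"
        unfolding e by (intro add_right_mono)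
      then have "sqrt 2 / 2 * (real (g C) - 1 + sqrt 2) \<le> real (g C)" by (simp only: mult_1_right diff_add_cancel)
      then show "sqrt 2 / 2 \<le> real (g C) / (real (g C) - 1 + sqrt 2)" using p by (simp add: pos_le_divide_eq)
    qed
    have "real (card S) * (sqrt 2 / 2) \<le> 2 + sqrt 2" unfolding plus[symmetric] using tl by (rule sum_bounded_below)
    then have "sqrt 2 * (card S * (sqrt 2 / 2)) \<le> sqrt 2 * (2 + sqrt 2)" by (intro mult_left_mono) auto
    then have "real (card S) \<le> 2 * sqrt 2 + 2" using sq by (simp add: algebra_simps)
    then have "real (card S) < 5" using s1 by linarith
    moreover have "2 + sqrt 2 \<le> real (card S) * 1" unfolding plus[symmetric] using tu by (rule sum_bounded_above)
    then have "real (card S) > 3" using s1 by linarith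
    ultimately show ?thesis by linarith
  qed
  define a b c where "a = card {C\<in>S. g C = 1}" and "b = card {C\<in>S. g C = 2}" and "c = card {C\<in>S. g C = 3}"
  define D where "D = {C\<in>S. 4 \<le> g C}"
  note split = sum_split_sizes[where g = g, OF fin pos, folded a_def b_def c_def D_def]
  have finD: "finite D" unfolding D_def using fin by simp
  have "real (card S) = real a + b + c + card D" using split[where h = "\<lambda>_. 1"] by simp
  then have k: "a + b + c + card D = 4" using card4 by linarith
  have F': "2 = - 2 * real b + 3 * real c + (\<Sum>C\<in>D. f1 (g C))"
    using split[where h = f1] F unfolding F_def by (simp add: f1_def q_def)
  have G': "- 1 = - real a / 2 - 2 * real b + 3 * real c / 2 + (\<Sum>C\<in>D. f2 (g C))"
    using split[where h = f2] G unfolding G_def by (simp add: f2_def q_def)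
  have big: "f1 m \<le> 12/7" "f2 m \<ge> 0" "f1 m > 1 + f2 m" if m: "4 \<le> m" for m
  proof -
    define r where "r = real m - 1"
    have r: "r \<ge> 3" using m by (simp add: r_def)
    have "3 * 3 \<le> r * r" using r by (intro mult_mono) auto
    then have qp: "q m > 0" by (simp add: q_def power2_eq_square flip: r_def)
    \<comment> \<open>The inequality \<open>f1 m \<le> 12/7\<close> with denominators cleared;
      equality holds at m = 4.\<close>
    have "0 \<le> (r - 3) * (5 * r + 8)" using r by auto
    then have "7 * (real m * (real m - 1)) \<le> 12 * q m"
      by (simp add: q_def power2_eq_square r_def algebra_simps)
    then show "f1 m \<le> 12/7" using qp by (simp add: f1_def divide_simps)
    show "f2 m \<ge> 0" using qp by (simp add: f2_def)
    have "real m * (real m - 1) = q m + real m + 1" by (simp add: q_def power2_eq_square algebra_simps)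
    then have "f1 m = 1 + f2 m + 1 / q m" using qp by (simp add: f1_def f2_def add_divide_distrib)
    then show "f1 m > 1 + f2 m" using qp by simp
  qed
  have gD: "4 \<le> g C" if "C \<in> D" for C using that by (simp add: D_def)
  have D0: "D = {}"
  proof (rule ccontr)
    assume "D \<noteq> {}"
    then have "(\<Sum>C\<in>D. 1 + f2 (g C)) < (\<Sum>C\<in>D. f1 (g C))"
      using finD big(3)[OF gD] by (intro sum_strict_mono) auto
    then have lo: "card D + (\<Sum>C\<in>D. f2 (g C)) < (\<Sum>C\<in>D. f1 (g C))" by (simp add: sum.distrib)
    have hi: "(\<Sum>C\<in>D. f1 (g C)) \<le> card D * (12/7)" using big(1)[OF gD] by (rule sum_bounded_above)
    have f2p: "0 \<le> (\<Sum>C\<in>D. f2 (g C))" using big(2)[OF gD] by (intro sum_nonneg) auto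
    have i1: "14 + 14 * real b \<le> 12 * real (card D) + 21 * real c" using F' hi by linarith
    \<comment> \<open>The difference of \<open>F'\<close> and \<open>G'\<close>, in which every size
      from 4 on counts for more than 1. Together with \<open>i1\<close> and a + b + c + card D = 4
      this leaves no solution with D nonempty.\<close>
    have i2: "3 * real c + 2 * real (card D) + real a < 6" using F' G' lo by linarith
    from i1 have "14 + 14 * b \<le> 12 * card D + 21 * c" by linarith
    moreover from i2 have "3 * c + 2 * card D + a < 6" by linarith
    moreover have "0 < card D" using \<open>D \<noteq> {}\<close> finD by (simp add: card_gt_0_iff)
    ultimately show False using k by linarith
  qed
  then have "2 + 2 * real b = 3 * real c" using F' by simp
  then have bc: "2 + 2 * b = 3 * c" by linarith
  moreover have abc4: "a + b + c = 4" using k D0 by simp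
  ultimately have "c \<le> 2" by linarith
  moreover have "c \<noteq> 0" using bc by simp
  moreover have "even (3 * c)" using bc by (metis dvd_add dvd_triv_left dvd_refl)
  then have "c \<noteq> 1" by auto
  ultimately have "c = 2" by linarith
  then have abc: "a = 0" "b = 2" "c = 2" using bc abc4 by linarith+
  have "real (\<Sum>C\<in>S. g C) = 10" using split[where h = real] D0 abc by simp
  then show "(\<Sum>C\<in>S. g C) = 10" by linarith
  have "real (\<Sum>C\<in>S. (g C)\<^sup>2) = 26" using split[where h = "\<lambda>m. (real m)\<^sup>2"] D0 abc by simp
  then show "(\<Sum>C\<in>S. (g C)\<^sup>2) = 26" by linarith
qed

section \<open>Cliques with pendant vertices\<close>

lemma sum_if_eq:
  fixes a b :: real
  assumes "finite S" "i \<in> S"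
  shows "(\<Sum>j\<in>S. if j = i then a else b) = a + b * (real (card S) - 1)"
proof -
  have "(\<Sum>j\<in>S. if j = i then a else b) = a + (\<Sum>j\<in>S - {i}. if j = i then a else b)"
    using assms by (simp add: sum.remove)
  also have "(\<Sum>j\<in>S - {i}. if j = i then a else b) = (\<Sum>j\<in>S - {i}. b)"
    by (intro sum.cong) auto
  also have "\<dots> = b * (real (card S) - 1)"
    using assms by (simp add: card_Diff_singleton of_nat_diff card_gt_0_iff Suc_leI mult.commute)
      (metis One_nat_def Suc_leI card_gt_0_iff empty_iff of_nat_1 of_nat_diff)
  finally show ?thesis .
qed

locale pendant_graph = conn_graph +
  fixes K assumes cp: "clique_with_pendants n E K"
begin

abbreviation L where "L \<equiv> {..<n} - K"

definition att :: "nat \<Rightarrow> nat" where "att v = (THE u. E v u)"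

lemma K_subset: "K \<subseteq> {..<n}" and K_clique: "\<And>x y. x \<in> K \<Longrightarrow> y \<in> K \<Longrightarrow> x \<noteq> y \<Longrightarrow> E x y"
  and two_pendants: "2 \<le> card L"
  using cp by (auto simp: clique_with_pendants_def)

lemma finite_K: "finite K" using K_subset finite_subset by blast

lemma K_less: "x \<in> K \<Longrightarrow> x < n" using K_subset by blast

lemma att_iff: assumes "v \<in> L" shows "E v x \<longleftrightarrow> x = att v" and "att v \<in> K"
proof -
  obtain u where u: "u \<in> K" "\<And>x. E v x \<longleftrightarrow> x = u"
    using cp assms unfolding clique_with_pendants_def by blast
  then have "att v = u" unfolding att_def by (intro the_equality) auto
  then show "E v x \<longleftrightarrow> x = att v" "att v \<in> K" using u by auto
qed

lemma att_inj: assumes "v \<in> L" "w \<in> L" "att v = att w" shows "v = w"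
proof -
  have "E (att v) v" "E (att v) w" using att_iff(1) assms adj_sym by metis+
  moreover have "att v \<in> K" using att_iff assms by blast
  ultimately show ?thesis using cp assms unfolding clique_with_pendants_def by blast
qed

lemma dist_KK: "x \<in> K \<Longrightarrow> y \<in> K \<Longrightarrow> d x y = (if y = x then 0 else 1)"
  using K_clique[of x y] dist_adj[of x y] K_less by auto

lemma dist_LK: assumes "v \<in> L" "x \<in> K" shows "d v x = (if x = att v then 1 else 2)"
proof (cases "x = att v")
  case True
  then show ?thesis using att_iff(1)[OF assms(1)] dist_adj by simp
next
  case False
  have "E v (att v)" "E (att v) x" using att_iff[OF assms(1)] K_clique assms False by auto
  moreover have "\<not> E v x" using att_iff(1)[OF assms(1)] False by simp
  ultimately show ?thesis using False dist_eq_2[of v x "att v"] assms by auto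
qed

lemma dist_KL: assumes "v \<in> L" "x \<in> K" shows "d x v = (if x = att v then 1 else 2)"
  using dist_LK[OF assms] dist_sym[of x v] assms K_less by auto

lemma dist_LL: assumes v: "v \<in> L" "w \<in> L" shows "d v w = (if w = v then 0 else 3)"
proof (cases "w = v")
  case True
  then show ?thesis using v by simp
next
  case False
  have ne: "att v \<noteq> att w" using att_inj v False by blast
  have lt: "v < n" "w < n" using v by auto
  have nE: "\<not> E v w" using att_iff[OF v(1)] v by auto
  have "d v (att w) = 2" using dist_LK[OF v(1) att_iff(2)[OF v(2)]] ne by simp
  moreover have "E (att w) w" using att_iff(1)[OF v(2)] adj_sym by blast
  ultimately have "d v w \<le> 3" using dist_step_le[OF lt(1)] by fastforce
  moreover have "d v w \<ge> 2" using dist_ge_2 lt False nE by blast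
  moreover have "d v w \<noteq> 2"
  proof
    assume "d v w = 2"
    then obtain x where "E v x" "E x w" using dist_eq_2_common_neighbour lt by blast
    then have "x = att v" "x = att w" using att_iff(1)[OF v(1)] att_iff(1)[OF v(2)] adj_sym by blast+
    then show False using ne by simp
  qed
  ultimately show ?thesis using False by simp
qed

lemma two_pendant_vertices:
  obtains p s where "p \<in> L" "s \<in> L" "p \<noteq> s"
proof -
  have "\<not> is_singleton L" using two_pendants by (simp add: is_singleton_altdef)
  moreover have "card L \<noteq> 0" using two_pendants by linarith
  then have "L \<noteq> {}" by (metis card.empty)
  ultimately show thesis using that by (metis ex_in_conv is_singletonI')
qed

lemma sum_dist_squares_pendant:
  "(\<Sum>i<n. \<Sum>j<n. (real (d i j))\<^sup>2) =
    (real n)\<^sup>2 - real n + 6 * real n * real (card L) + 2 * (real (card L))\<^sup>2 - 14 * real (card L)"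
proof -
  define s t where "s = real (card K)" and "t = real (card L)"
  have fin: "finite L" "K \<inter> L = {}" "K \<union> L = {..<n}" using K_subset by auto
  have "card {..<n} = card K + card L" using card_Un_disjoint[OF finite_K fin(1,2)] fin(3) by simp
  then have n: "real n = s + t" by (simp add: s_def t_def)
  have split: "(\<Sum>j<n. f j) = (\<Sum>j\<in>K. f j) + (\<Sum>j\<in>L. f j)" for f :: "nat \<Rightarrow> real"
    using sum.union_disjoint[OF finite_K fin(1,2), of f] fin(3) by simp
  have KK: "(\<Sum>j\<in>K. (real (d i j))\<^sup>2) = s - 1" if "i \<in> K" for i
  proof -
    have "(\<Sum>j\<in>K. (real (d i j))\<^sup>2) = (\<Sum>j\<in>K. if j = i then 0 else 1)"
      using that by (intro sum.cong) (auto simp: dist_KK)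
    then show ?thesis using sum_if_eq[OF finite_K that, of 0 1] by (simp add: s_def)
  qed
  have LK: "(\<Sum>j\<in>K. (real (d i j))\<^sup>2) = 1 + 4 * (s - 1)" if "i \<in> L" for i
  proof -
    have "(\<Sum>j\<in>K. (real (d i j))\<^sup>2) = (\<Sum>j\<in>K. if j = att i then 1 else 4)"
      using that by (intro sum.cong) (auto simp: dist_LK)
    then show ?thesis using sum_if_eq[OF finite_K att_iff(2)[OF that], of 1 4] by (simp add: s_def)
  qed
  have LL: "(\<Sum>j\<in>L. (real (d i j))\<^sup>2) = 9 * (t - 1)" if "i \<in> L" for i
  proof -
    have "(\<Sum>j\<in>L. (real (d i j))\<^sup>2) = (\<Sum>j\<in>L. if j = i then 0 else 9)"
      using that by (intro sum.cong) (auto simp: dist_LL)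
    then show ?thesis using sum_if_eq[OF fin(1) that, of 0 9] by (simp add: t_def)
  qed
  have "(\<Sum>i\<in>K. \<Sum>j\<in>L. (real (d i j))\<^sup>2) = (\<Sum>j\<in>L. \<Sum>i\<in>K. (real (d i j))\<^sup>2)" by (rule sum.swap)
  also have "\<dots> = (\<Sum>j\<in>L. \<Sum>i\<in>K. (real (d j i))\<^sup>2)"
    using K_less by (intro sum.cong refl) (simp add: dist_sym)
  finally have KL: "(\<Sum>i\<in>K. \<Sum>j\<in>L. (real (d i j))\<^sup>2) = t * (1 + 4 * (s - 1))"
    using LK by (simp add: t_def)
  have "(\<Sum>i<n. \<Sum>j<n. (real (d i j))\<^sup>2) =
    (\<Sum>i\<in>K. \<Sum>j\<in>K. (real (d i j))\<^sup>2) + (\<Sum>i\<in>K. \<Sum>j\<in>L. (real (d i j))\<^sup>2)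
    + ((\<Sum>i\<in>L. \<Sum>j\<in>K. (real (d i j))\<^sup>2) + (\<Sum>i\<in>L. \<Sum>j\<in>L. (real (d i j))\<^sup>2))"
    by (simp only: split sum.distrib)
  also have "\<dots> = s * (s - 1) + t * (1 + 4 * (s - 1)) + (t * (1 + 4 * (s - 1)) + t * (9 * (t - 1)))"
    unfolding KL using KK LK LL by (simp add: s_def t_def)
  also have "\<dots> = (real n)\<^sup>2 - real n + 6 * real n * t + 2 * t\<^sup>2 - 14 * t"
    unfolding n by (simp add: power2_eq_square algebra_simps)
  finally show ?thesis by (simp add: t_def)
qed

text \<open>Antisymmetric vectors supported on two pendant vertices and their neighbours span an
  invariant plane with characteristic polynomial \<open>x^2 + 4x + 2\<close>.\<close>

lemma pendant_eigenvalue: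
  fixes \<alpha> :: real
  assumes root: "\<alpha>\<^sup>2 + 4 * \<alpha> + 2 = 0"
  shows "poly (char_poly (dist_matrix n E)) \<alpha> = 0"
proof -
  obtain p s where ps: "p \<in> L" "s \<in> L" "p \<noteq> s" using two_pendant_vertices .
  define q r where "q = att p" and "r = att s"
  have qr: "q \<in> K" "r \<in> K" "q \<noteq> r" using att_iff(2) att_inj ps unfolding q_def r_def by blast+
  \<comment> \<open>Row q of the eigenvalue equation reads -1 - a = \<alpha> and fixes a; row p
    reads -1 - 3 a = \<alpha> a, which is then the quadratic equation for \<alpha>.\<close>
  define a where "a = - 1 - \<alpha>"
  define w where "w j = of_bool (j = q) - of_bool (j = r) + a * of_bool (j = p) - a * of_bool (j = s)" for j
  have lt: "p < n" "s < n" "q < n" "r < n" using ps qr K_less by auto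
  have single: "(\<Sum>j<n. f j * (c * of_bool (j = k))) = c * f k" if "k < n" for f :: "nat \<Rightarrow> real" and c k
  proof -
    have "(\<Sum>j<n. f j * (c * of_bool (j = k))) = (\<Sum>j<n. if j = k then c * f k else 0)"
      by (intro sum.cong) auto
    then show ?thesis using that by simp
  qed
  have row: "(\<Sum>j<n. real (d i j) * w j) = \<alpha> * w i" if i: "i < n" for i
  proof -
    have "(\<Sum>j<n. real (d i j) * w j) = real (d i q) - real (d i r) + a * real (d i p) - a * real (d i s)"
    proof -
      have "(\<Sum>j<n. real (d i j) * w j) = (\<Sum>j<n. real (d i j) * (1 * of_bool (j = q)) + real (d i j) * (- 1 * of_bool (j = r))
          + real (d i j) * (a * of_bool (j = p)) + real (d i j) * (- a * of_bool (j = s)))"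
        unfolding w_def by (intro sum.cong refl) (simp only: algebra_simps)
      also have "\<dots> = 1 * real (d i q) + - 1 * real (d i r) + a * real (d i p) + - a * real (d i s)"
        unfolding sum.distrib single[OF lt(1)] single[OF lt(2)] single[OF lt(3)] single[OF lt(4)] ..
      finally show ?thesis by simp
    qed
    also have "\<dots> = \<alpha> * w i"
    proof (cases "i \<in> K")
      case True
      then have D: "d i q = (if q = i then 0 else 1)" "d i r = (if r = i then 0 else 1)"
        "d i p = (if i = q then 1 else 2)" "d i s = (if i = r then 1 else 2)"
        using dist_KK[OF True qr(1)] dist_KK[OF True qr(2)] dist_KL[OF ps(1) True] dist_KL[OF ps(2) True]
        by (simp_all only: q_def r_def)
      have "i \<noteq> p" "i \<noteq> s" using True ps by auto
      then show ?thesis using qr(3) unfolding D w_def a_def by auto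
    next
      case False
      then have iL: "i \<in> L" using i by simp
      have eq: "q = att i \<longleftrightarrow> i = p" "r = att i \<longleftrightarrow> i = s"
        using att_inj[OF iL ps(1)] att_inj[OF iL ps(2)] unfolding q_def r_def by metis+
      have D: "d i q = (if i = p then 1 else 2)" "d i r = (if i = s then 1 else 2)"
        "d i p = (if p = i then 0 else 3)" "d i s = (if s = i then 0 else 3)"
        using dist_LK[OF iL qr(1)] dist_LK[OF iL qr(2)] dist_LL[OF iL ps(1)] dist_LL[OF iL ps(2)] eq by auto
      have "i \<noteq> q" "i \<noteq> r" using False qr by auto
      moreover have "\<alpha> * a = - 1 - 3 * a" using root by (simp add: a_def power2_eq_square algebra_simps)
      ultimately show ?thesis using ps(3) unfolding D w_def by (auto simp: algebra_simps)
    qed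
    finally show ?thesis .
  qed
  have "dist_matrix n E *\<^sub>v vec n w = \<alpha> \<cdot>\<^sub>v vec n w"
  proof (rule eq_vecI)
    fix i assume "i < dim_vec (\<alpha> \<cdot>\<^sub>v vec n w)"
    then have i: "i < n" by simp
    have "(dist_matrix n E *\<^sub>v vec n w) $ i = (\<Sum>j<n. real (d i j) * w j)"
      using i by (simp add: dist_matrix_def scalar_prod_def lessThan_atLeast0)
    then show "(dist_matrix n E *\<^sub>v vec n w) $ i = (\<alpha> \<cdot>\<^sub>v vec n w) $ i" using row[OF i] i by simp
  qed (simp add: dist_matrix_def)
  moreover have "vec n w \<noteq> 0\<^sub>v n"
  proof
    assume "vec n w = 0\<^sub>v n"
    then have "vec n w $ q = 0" using lt by simp
    then have "w q = 0" using lt by simp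
    moreover have "q \<noteq> p" "q \<noteq> s" using qr ps by auto
    ultimately show False using qr(3) by (simp add: w_def)
  qed
  ultimately have "eigenvector (dist_matrix n E) (vec n w) \<alpha>"
    unfolding eigenvector_def using dist_matrix_carrier by auto
  then have "eigenvalue (dist_matrix n E) \<alpha>" unfolding eigenvalue_def by blast
  then show ?thesis using eigenvalue_root_char_poly[OF dist_matrix_carrier] by simp
qed

end

text \<open>Any bijection \<open>g\<close> of the pendant vertices dictates the images of their
  neighbours; the clique vertices without pendant are equal in number on both sides and may be
  matched arbitrarily.\<close>

lemma pendant_graphs_iso:
  assumes G: "pendant_graph n E K" and H: "pendant_graph n F K'"
    and card: "card ({..<n} - K) = card ({..<n} - K')"
  shows "graph_iso n E n F"
proof -
  interpret G: pendant_graph n E K by (rule G)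
  interpret H: pendant_graph n F K' by (rule H)
  obtain g where g: "bij_betw g G.L H.L"
    using finite_same_card_bij[of G.L H.L] card by auto
  define A A' where "A = G.att ` G.L" and "A' = H.att ` H.L"
  have A: "A \<subseteq> K" "A' \<subseteq> K'" using G.att_iff(2) H.att_iff(2) by (auto simp: A_def A'_def)
  have inj: "inj_on G.att G.L" "inj_on H.att H.L" using G.att_inj H.att_inj by (auto simp: inj_on_def)
  have "card A = card A'" unfolding A_def A'_def using card inj by (simp add: card_image)
  moreover have "card K = card K'"
  proof -
    have "card K = n - card G.L" "card K' = n - card H.L"
      using G.K_subset H.K_subset card_Diff_subset[OF G.finite_K G.K_subset] card_Diff_subset[OF H.finite_K H.K_subset]
        card_mono[OF _ G.K_subset] card_mono[OF _ H.K_subset] by auto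
    then show ?thesis using card by simp
  qed
  ultimately have "card (K - A) = card (K' - A')"
    using A finite_subset[OF A(1) G.finite_K] finite_subset[OF A(2) H.finite_K] by (simp add: card_Diff_subset)
  then obtain h where h: "bij_betw h (K - A) (K' - A')"
    using finite_same_card_bij[of "K - A" "K' - A'"] G.finite_K H.finite_K by auto
  define a where "a = inv_into G.L G.att"
  have aA: "bij_betw (\<lambda>u. H.att (g (a u))) A A'"
  proof -
    have "bij_betw a A G.L" unfolding a_def A_def using inj(1) by (intro bij_betw_inv_into) (simp add: bij_betw_def)
    moreover have "bij_betw H.att H.L A'" unfolding A'_def using inj(2) by (simp add: bij_betw_def)
    ultimately show ?thesis using g bij_betw_trans[of a A G.L "\<lambda>v. H.att (g v)" A'] bij_betw_trans[of g G.L H.L H.att A']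
      by (simp add: comp_def)
  qed
  define f where "f u = (if u \<in> G.L then g u else if u \<in> A then H.att (g (a u)) else h u)" for u
  have fL: "bij_betw f G.L H.L" using g by (rule bij_betw_cong[THEN iffD1, rotated]) (simp add: f_def)
  have fA: "bij_betw f A A'" using aA by (rule bij_betw_cong[THEN iffD1, rotated]) (use A in \<open>auto simp: f_def\<close>)
  have fR: "bij_betw f (K - A) (K' - A')" using h by (rule bij_betw_cong[THEN iffD1, rotated]) (auto simp: f_def)
  have "bij_betw f (A \<union> (K - A)) (A' \<union> (K' - A'))" using fA fR by (rule bij_betw_combine) auto
  moreover have "A \<union> (K - A) = K" "A' \<union> (K' - A') = K'" using A by auto
  ultimately have fK: "bij_betw f K K'" by simp
  have "bij_betw f (K \<union> G.L) (K' \<union> H.L)" using fK fL by (rule bij_betw_combine) auto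
  moreover have "K \<union> G.L = {..<n}" "K' \<union> H.L = {..<n}" using G.K_subset H.K_subset by auto
  ultimately have bij: "bij_betw f {..<n} {..<n}" by simp
  have inK: "f u \<in> K' \<longleftrightarrow> u \<in> K" if "u < n" for u
  proof -
    have "f u \<in> K'" if "u \<in> K" using fK that by (auto simp: bij_betw_def)
    moreover have "f u \<notin> K'" if "u \<in> G.L" using fL that by (auto simp: bij_betw_def)
    ultimately show ?thesis using that by blast
  qed
  have fatt: "H.att (f v) = f (G.att v)" if v: "v \<in> G.L" for v
  proof -
    have "G.att v \<in> A" "G.att v \<in> K" using v A by (auto simp: A_def)
    moreover have "a (G.att v) = v" unfolding a_def using inj(1) v by simp
    ultimately show ?thesis using v by (simp add: f_def)
  qed
  have finj: "f u = f v \<longleftrightarrow> u = v" if "u < n" "v < n" for u v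
    using bij that by (auto simp: bij_betw_def inj_on_def)
  have fle: "f u < n" if "u < n" for u using bij that by (auto simp: bij_betw_def)
  have LE: "E u v \<longleftrightarrow> F (f u) (f v)" if u: "u \<in> G.L" "v < n" for u v
  proof -
    have "f u \<in> H.L" using u fL by (auto simp: bij_betw_def)
    then have "F (f u) (f v) \<longleftrightarrow> f v = f (G.att u)" using H.att_iff(1) fatt[OF u(1)] by simp
    also have "\<dots> \<longleftrightarrow> v = G.att u" using finj u G.att_iff(2)[OF u(1)] G.K_less by blast
    finally show ?thesis using G.att_iff(1)[OF u(1)] by simp
  qed
  have "E u v \<longleftrightarrow> F (f u) (f v)" if uv: "u < n" "v < n" for u v
  proof (cases "u \<in> K \<and> v \<in> K")
    case True
    have "E u v \<longleftrightarrow> u \<noteq> v" using G.K_clique True G.adj_irrefl by blast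
    also have "\<dots> \<longleftrightarrow> f u \<noteq> f v" using finj uv by blast
    also have "\<dots> \<longleftrightarrow> F (f u) (f v)" using H.K_clique inK True uv H.adj_irrefl by metis
    finally show ?thesis .
  next
    case False
    then show ?thesis using LE[of u v] LE[of v u] uv G.adj_sym H.adj_sym by blast
  qed
  then show ?thesis unfolding graph_iso_def using bij by blast
qed

section \<open>Comparison of spectra\<close>

text \<open>Turns equality of the blade sizes, counted with multiplicity, into a matching of the
  blades.\<close>

lemma image_mset_eq_obtain_bij:
  assumes "finite A" "finite B" "image_mset f (mset_set A) = image_mset g (mset_set B)"
  shows "\<exists>\<phi>. bij_betw \<phi> A B \<and> (\<forall>a\<in>A. g (\<phi> a) = f a)"
  using assms
proof (induction A arbitrary: B rule: finite_induct)
  case empty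
  then have "B = {}" by (simp add: mset_set_empty_iff)
  then show ?case by (simp add: bij_betw_def)
next
  case (insert a A)
  have "f a \<in># image_mset g (mset_set B)" using insert.prems(2)[symmetric] insert.hyps by simp
  then obtain b where b: "b \<in> B" "g b = f a" using insert.prems(1) by auto
  have "mset_set B = add_mset b (mset_set (B - {b}))"
    using b insert.prems(1) by (simp add: mset_set.remove)
  then have "image_mset f (mset_set A) = image_mset g (mset_set (B - {b}))"
    using insert.prems(2) insert.hyps b by simp
  then obtain \<phi> where \<phi>: "bij_betw \<phi> A (B - {b})" "\<forall>a\<in>A. g (\<phi> a) = f a"
    using insert.IH insert.prems(1) by blast
  define \<psi> where "\<psi> = \<phi>(a := b)"
  have "bij_betw \<psi> A (B - {b})"
    using \<phi>(1) insert.hyps by (subst bij_betw_cong[of _ _ \<phi>]) (auto simp: \<psi>_def)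
  moreover have "bij_betw \<psi> {a} {b}" by (simp add: \<psi>_def bij_betw_def)
  ultimately have "bij_betw \<psi> (A \<union> {a}) ((B - {b}) \<union> {b})" by (rule bij_betw_combine) auto
  moreover have "(B - {b}) \<union> {b} = B" using b by auto
  ultimately have "bij_betw \<psi> (insert a A) B" by simp
  moreover have "\<forall>x\<in>insert a A. g (\<psi> x) = f x" using \<phi>(2) b insert.hyps by (auto simp: \<psi>_def)
  ultimately show ?case by blast
qed

context windmill_graph
begin

lemma adj_iff_blade:
  assumes "u < n" "v < n" "u \<noteq> z" "v \<noteq> z"
  shows "E u v \<longleftrightarrow> u \<noteq> v \<and> blade u = blade v"
proof
  assume E: "E u v"
  then have "v \<in> blade u" using assms by (simp add: blade_def)
  then show "u \<noteq> v \<and> blade u = blade v" using blade_eq[of u v] assms E adj_irrefl by auto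
next
  assume *: "u \<noteq> v \<and> blade u = blade v"
  have "v \<in> blade v" using assms by (simp add: blade_def)
  then have "v \<in> blade u" using * by simp
  then show "E u v" using * by (auto simp: blade_def)
qed

lemma blade_poly_roots:
  "proots blade_poly = image_mset (\<lambda>C. - (1 + real (card C))) (mset_set blades)"
proof -
  have "proots (\<Prod>C\<in>\<C>. [:1 + real (card C), 1:]) = image_mset (\<lambda>C. - (1 + real (card C))) (mset_set \<C>)"
    if "finite \<C>" for \<C> :: "nat set set"
    using that
  proof (induction \<C> rule: finite_induct)
    case (insert C \<C>)
    have "(\<Prod>C\<in>\<C>. [:1 + real (card C), 1:]) \<noteq> 0" using insert.hyps by simp
    then show ?case using insert by (simp add: proots_mult del: mult_pCons_left)
  qed simp
  then show ?thesis unfolding blade_poly_def using finite_blades .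
qed

text \<open>At -1 the derivative term vanishes and the value is (k - 1) P(-1), nonzero for k at
  least 2. Hence the multiplicity of the eigenvalue -1 reveals the number of blades.\<close>

lemma windmill_poly_nonzero_at_neg1:
  assumes "2 \<le> card blades"
  shows "poly (windmill_poly (card blades) blade_poly) (- 1) \<noteq> 0"
proof -
  have "poly blade_poly (- 1) \<noteq> 0"
    unfolding poly_blade_poly using finite_blades finite_blade blades_nonempty by simp
  moreover have "poly (windmill_poly (card blades) blade_poly) (- 1) = (real (card blades) - 1) * poly blade_poly (- 1)"
    by (simp add: windmill_poly_def algebra_simps)
  ultimately show ?thesis using assms by simp
qed

lemma two_blades:
  assumes "a < n" "b < n" "a \<noteq> b" "\<not> E a b"
  shows "2 \<le> card blades"
proof -
  have z: "a \<noteq> z" "b \<noteq> z" using hub(2) adj_sym assms by blast+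
  then have "blade a \<noteq> blade b" using adj_iff_blade assms by blast
  then have "card {blade a, blade b} = 2" by simp
  moreover have "{blade a, blade b} \<subseteq> blades" using assms z by (auto simp: blades_def)
  ultimately show ?thesis using finite_blades card_mono by metis
qed

lemma sum_card_blades: "(\<Sum>C\<in>blades. card C) = n - 1"
proof -
  have "card (\<Union>blades) = (\<Sum>C\<in>blades. card C)"
    using blades_disjoint finite_blade by (intro card_Union_disjoint) auto
  then show ?thesis unfolding blades_Union using hub(1) by simp
qed

lemma sum_dist_squares_windmill:
  "(\<Sum>i<n. \<Sum>j<n. (real (d i j))\<^sup>2) =
    (real n - 1) + 4 * (real n - 1)\<^sup>2 - 3 * (\<Sum>C\<in>blades. (real (card C))\<^sup>2)"
proof -
  have n1: "1 \<le> n" using hub(1) by simp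
  have zrow: "(\<Sum>j<n. (real (d z j))\<^sup>2) = real n - 1"
  proof -
    have "(\<Sum>j<n. (real (d z j))\<^sup>2) = (\<Sum>j<n. if j = z then 0 else 1)"
      using hub(1) by (intro sum.cong) (auto simp: dist_windmill)
    then show ?thesis using sum_if_eq[of "{..<n}" z 0 1] hub(1) by simp
  qed
  have row: "(\<Sum>j<n. (real (d i j))\<^sup>2) = 4 * (real n - 1) - 3 * card (blade i)" if i: "i < n" "i \<noteq> z" for i
  proof -
    have sub: "blade i \<subseteq> {..<n}" "i \<in> blade i" using i by (auto simp: blade_def)
    \<comment> \<open>Start from 4 everywhere and subtract 3 on the blade, 3 at the hub, and a
      further 1 at i itself, which belongs to its blade.\<close>
    have "(\<Sum>j<n. (real (d i j))\<^sup>2) = (\<Sum>j<n. 4 - 3 * (of_bool (j \<in> blade i) * 1) + (if j = i then - 1 else 0) + (if j = z then - 3 else 0))"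
      using i hub(1) sub by (intro sum.cong) (auto simp: dist_windmill blade_def)
    also have "\<dots> = 4 * real n - 3 * card (blade i) - 1 - 3"
      unfolding sum.distrib sum_subtractf sum_distrib_left[symmetric] sum_indicator_subset[OF sub(1)]
      using i hub(1) by simp
    finally show ?thesis by simp
  qed
  have "(\<Sum>i<n. \<Sum>j<n. (real (d i j))\<^sup>2) =
      (\<Sum>j<n. (real (d z j))\<^sup>2) + (\<Sum>i\<in>{..<n} - {z}. \<Sum>j<n. (real (d i j))\<^sup>2)"
    using hub(1) by (intro sum.remove) auto
  also have "(\<Sum>i\<in>{..<n} - {z}. \<Sum>j<n. (real (d i j))\<^sup>2) = (\<Sum>C\<in>blades. \<Sum>i\<in>C. \<Sum>j<n. (real (d i j))\<^sup>2)"
    by (rule sum_over_blades)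
  also have "\<dots> = (\<Sum>C\<in>blades. real (card C) * (4 * (real n - 1) - 3 * card C))"
  proof (rule sum.cong[OF refl])
    fix C assume C: "C \<in> blades"
    have "(\<Sum>i\<in>C. \<Sum>j<n. (real (d i j))\<^sup>2) = (\<Sum>i\<in>C. 4 * (real n - 1) - 3 * card C)"
    proof (rule sum.cong[OF refl])
      fix i assume "i \<in> C"
      then have "i < n" "i \<noteq> z" using C blades_Union by blast+
      moreover from this have "blade i = C" using in_blades_iff[of i C] C \<open>i \<in> C\<close> by blast
      ultimately show "(\<Sum>j<n. (real (d i j))\<^sup>2) = 4 * (real n - 1) - 3 * card C" using row by simp
    qed
    then show "(\<Sum>i\<in>C. \<Sum>j<n. (real (d i j))\<^sup>2) = real (card C) * (4 * (real n - 1) - 3 * card C)" by simp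
  qed
  also have "\<dots> = 4 * (real n - 1) * (\<Sum>C\<in>blades. real (card C)) - 3 * (\<Sum>C\<in>blades. (real (card C))\<^sup>2)"
    by (simp add: sum_distrib_left sum_subtractf[symmetric] power2_eq_square algebra_simps)
  also have "(\<Sum>C\<in>blades. real (card C)) = real n - 1"
    using sum_card_blades n1 by (metis of_nat_1 of_nat_diff of_nat_sum)
  finally show ?thesis unfolding zrow by (simp add: power2_eq_square)
qed

lemma windmill_root_equation:
  assumes root: "poly (char_poly (dist_matrix n E)) \<alpha> = 0" and a1: "\<alpha> \<noteq> - 1"
    and nz: "\<And>C. C \<in> blades \<Longrightarrow> \<alpha> + 1 + card C \<noteq> 0"
  shows "\<alpha> = (1 + 2 * \<alpha>) * (\<Sum>C\<in>blades. real (card C) / (\<alpha> + 1 + card C))"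
proof -
  have "poly ([:1, 1:] ^ (n - 1) * windmill_poly (card blades) blade_poly) \<alpha> = 0"
    unfolding char_poly_windmill[symmetric] using root by simp
  then have "poly (windmill_poly (card blades) blade_poly) \<alpha> = 0"
    using a1 by (auto simp: add_eq_0_iff)
  moreover have "poly blade_poly \<alpha> \<noteq> 0" unfolding poly_blade_poly using nz finite_blades by simp
  ultimately show ?thesis using poly_windmill_poly[of \<alpha>] nz by simp
qed

lemma windmill_conjugate_roots:
  assumes roots: "poly (char_poly (dist_matrix n E)) (- 2 + sqrt 2) = 0"
    "poly (char_poly (dist_matrix n E)) (- 2 - sqrt 2) = 0"
  shows "n = 11" "(\<Sum>i<n. \<Sum>j<n. (real (d i j))\<^sup>2) = 332"
proof -
  have s: "sqrt 2 * sqrt 2 = (2::real)" by simp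
  have ir: "real m - 1 \<noteq> sqrt 2 \<and> real m - 1 \<noteq> - sqrt 2" for m :: nat
    using pred_square_neq_2[of m] by auto
  have s1: "sqrt 2 \<noteq> (1::real)" "sqrt 2 \<noteq> (- 1::real)" using ir[of 2] ir[of 0] by auto
  have plus: "(\<Sum>C\<in>blades. real (card C) / (real (card C) - 1 + sqrt 2)) = 2 + sqrt 2" (is "?S = _")
  proof -
    have "- 2 + sqrt 2 = (1 + 2 * (- 2 + sqrt 2)) * (\<Sum>C\<in>blades. real (card C) / (- 2 + sqrt 2 + 1 + card C))"
      by (rule windmill_root_equation[OF roots(1)]) (use ir s1 in \<open>auto simp: algebra_simps\<close>)
    also have "(\<Sum>C\<in>blades. real (card C) / (- 2 + sqrt 2 + 1 + card C)) = ?S"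
      by (intro sum.cong refl) (simp add: algebra_simps)
    \<comment> \<open>The coefficient 1 + 2 (-2 + sqrt 2) = -3 + 2 sqrt 2 is a unit: times its
      conjugate it gives 9 - 8 = 1.\<close>
    finally have "(- 3 - 2 * sqrt 2) * (- 2 + sqrt 2) = (- 3 - 2 * sqrt 2) * ((- 3 + 2 * sqrt 2) * ?S)" by simp
    also have "\<dots> = (9 - 4 * (sqrt 2 * sqrt 2)) * ?S" by (simp only: algebra_simps)
    finally show ?thesis unfolding s using s by (simp add: algebra_simps)
  qed
  have minus: "(\<Sum>C\<in>blades. real (card C) / (real (card C) - 1 - sqrt 2)) = 2 - sqrt 2" (is "?T = _")
  proof -
    have "- 2 - sqrt 2 = (1 + 2 * (- 2 - sqrt 2)) * (\<Sum>C\<in>blades. real (card C) / (- 2 - sqrt 2 + 1 + card C))"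
      by (rule windmill_root_equation[OF roots(2)]) (use ir s1 in \<open>auto simp: algebra_simps\<close>)
    also have "(\<Sum>C\<in>blades. real (card C) / (- 2 - sqrt 2 + 1 + card C)) = ?T"
      by (intro sum.cong refl) (simp add: algebra_simps)
    finally have "(- 3 + 2 * sqrt 2) * (- 2 - sqrt 2) = (- 3 + 2 * sqrt 2) * ((- 3 - 2 * sqrt 2) * ?T)" by simp
    also have "\<dots> = (9 - 4 * (sqrt 2 * sqrt 2)) * ?T" by (simp only: algebra_simps)
    finally show ?thesis unfolding s using s by (simp add: algebra_simps)
  qed
  note sizes = conjugate_size_equations[OF finite_blades card_blade_pos plus minus]
  show n: "n = 11" using sizes(1) sum_card_blades by simp
  have "(\<Sum>C\<in>blades. (real (card C))\<^sup>2) = real (\<Sum>C\<in>blades. (card C)\<^sup>2)" by simp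
  also have "\<dots> = real 26" by (simp only: sizes(2))
  finally show "(\<Sum>i<n. \<Sum>j<n. (real (d i j))\<^sup>2) = 332"
    unfolding sum_dist_squares_windmill by (simp add: n)
qed

end

lemma windmills_iso:
  assumes G: "windmill_graph n E z" and H: "windmill_graph n F z'"
    and k: "2 \<le> card (windmill_graph.blades n E z)" "2 \<le> card (windmill_graph.blades n F z')"
    and chi: "char_poly (dist_matrix n E) = char_poly (dist_matrix n F)"
  shows "graph_iso n E n F"
proof -
  interpret G: windmill_graph n E z by (rule G)
  interpret H: windmill_graph n F z' by (rule H)
  let ?Q = "windmill_poly (card G.blades) G.blade_poly" and ?Q' = "windmill_poly (card H.blades) H.blade_poly"
  \<comment> \<open>Comparing powers of X + 1: if b exceeded a, then \<open>q'\<close> would be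
    divisible by X + 1. Used in both directions it equates the numbers of blades.\<close>
  have le: "\<not> a < b" if "p * [:1, 1:] ^ a = [:1, 1:] ^ m * q" "p * [:1, 1:] ^ b = [:1, 1:] ^ m * q'" "poly q' (- 1) \<noteq> 0"
    for a b m and p q q' :: "real poly"
  proof
    assume ab: "a < b"
    have "[:1, 1:] ^ m * q' = p * [:1, 1:] ^ a * [:1, 1:] ^ (b - a)"
      using ab that(2) by (simp add: mult.assoc flip: power_add)
    also have "\<dots> = [:1, 1:] ^ m * (q * [:1, 1:] ^ (b - a))" unfolding that(1) by (simp only: mult.assoc)
    finally have "q' = q * [:1, 1:] ^ (b - a)" by simp
    then have "poly q' (- 1) = 0" using ab by simp
    then show False using that(3) by simp
  qed
  note W = G.char_poly_windmill and W' = H.char_poly_windmill[folded chi]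
  have kk: "card G.blades = card H.blades"
    using le[OF W W' H.windmill_poly_nonzero_at_neg1[OF k(2)]] le[OF W' W G.windmill_poly_nonzero_at_neg1[OF k(1)]]
    by simp
  have "[:1, 1:] ^ (n - 1) * ?Q = [:1, 1:] ^ (n - 1) * ?Q'" using W W' kk by metis
  then have "?Q = ?Q'" by simp
  then have "G.blade_poly = H.blade_poly" using windmill_poly_inject kk by metis
  then have "image_mset (\<lambda>C. - (1 + real (card C))) (mset_set G.blades) = image_mset (\<lambda>C. - (1 + real (card C))) (mset_set H.blades)"
    using G.blade_poly_roots H.blade_poly_roots by simp
  from image_mset_eq_obtain_bij[OF G.finite_blades H.finite_blades this]
  obtain \<phi> where \<phi>: "bij_betw \<phi> G.blades H.blades" "\<And>C. C \<in> G.blades \<Longrightarrow> card (\<phi> C) = card C"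
    by auto
  have "\<exists>h. bij_betw h C (\<phi> C)" if "C \<in> G.blades" for C
    using finite_same_card_bij[of C "\<phi> C"] that \<phi> G.finite_blade H.finite_blade
    by (metis bij_betwE)
  then obtain h where h: "\<And>C. C \<in> G.blades \<Longrightarrow> bij_betw (h C) C (\<phi> C)" by metis
  define f where "f u = (if u = z then z' else h (G.blade u) u)" for u
  have Gb: "G.blade u \<in> G.blades" "u \<in> G.blade u" if "u < n" "u \<noteq> z" for u
    using that by (auto simp: G.blades_def G.blade_def)
  have f: "f u < n" "f u \<noteq> z'" "H.blade (f u) = \<phi> (G.blade u)" if u: "u < n" "u \<noteq> z" for u
  proof -
    have "f u \<in> \<phi> (G.blade u)" using h[OF Gb(1)[OF u]] Gb(2)[OF u] u by (auto simp: f_def bij_betw_def)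
    moreover have \<phi>H: "\<phi> (G.blade u) \<in> H.blades" using \<phi>(1) Gb(1)[OF u] by (auto simp: bij_betw_def)
    ultimately show *: "f u < n" "f u \<noteq> z'" using H.blades_Union by blast+
    show "H.blade (f u) = \<phi> (G.blade u)"
      using H.in_blades_iff[OF *, of "\<phi> (G.blade u)"] \<open>f u \<in> \<phi> (G.blade u)\<close> \<phi>H by simp
  qed
  have blade_inj: "\<phi> (G.blade u) = \<phi> (G.blade v) \<longleftrightarrow> G.blade u = G.blade v"
    if "u < n" "u \<noteq> z" "v < n" "v \<noteq> z" for u v
    using \<phi>(1) Gb(1) that by (metis bij_betw_imp_inj_on inj_on_eq_iff)
  have inj: "u = v" if uv: "u < n" "v < n" "f u = f v" for u v
  proof (cases "u = z \<or> v = z")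
    case True
    then show ?thesis using f(2)[of u] f(2)[of v] uv by (auto simp: f_def split: if_splits)
  next
    case False
    then have same: "G.blade u = G.blade v" using f(3)[of u] f(3)[of v] uv blade_inj by metis
    then have "h (G.blade u) u = h (G.blade u) v" using uv False by (simp add: f_def)
    then show ?thesis
      using h[OF Gb(1)[of u]] Gb(2)[of u] Gb(2)[of v] same False uv by (auto simp: bij_betw_def inj_on_def)
  qed
  have "f ` {..<n} \<subseteq> {..<n}" using f(1) H.hub(1) by (auto simp: f_def split: if_splits)
  moreover have "inj_on f {..<n}" using inj by (auto simp: inj_on_def)
  ultimately have bij: "bij_betw f {..<n} {..<n}"
    by (simp add: bij_betw_def endo_inj_surj)
  have "E u v \<longleftrightarrow> F (f u) (f v)" if uv: "u < n" "v < n" for u v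
  proof -
    consider "u = v" | "u \<noteq> v" "u = z" | "u \<noteq> v" "v = z" | "u \<noteq> v" "u \<noteq> z" "v \<noteq> z" by blast
    then show ?thesis
    proof cases
      case 1
      then show ?thesis using G.adj_irrefl H.adj_irrefl by simp
    next
      case 2
      then have "E u v" using G.hub(2) uv by auto
      moreover have "f u = z'" "f v < n" "f v \<noteq> z'" using 2 f[of v] uv by (auto simp: f_def)
      ultimately show ?thesis using H.hub(2) by simp
    next
      case 3
      then have "E u v" using G.hub(2) uv G.adj_sym by auto
      moreover have "f v = z'" "f u < n" "f u \<noteq> z'" using 3 f[of u] uv by (auto simp: f_def)
      ultimately show ?thesis using H.hub(2) H.adj_sym by simp
    next
      case 4
      have "E u v \<longleftrightarrow> G.blade u = G.blade v" using G.adj_iff_blade uv 4 by blast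
      also have "\<dots> \<longleftrightarrow> f u \<noteq> f v \<and> H.blade (f u) = H.blade (f v)"
        using f(3)[of u] f(3)[of v] blade_inj[of u v] inj[of u v] uv 4 by metis
      also have "\<dots> \<longleftrightarrow> F (f u) (f v)" using H.adj_iff_blade f uv 4 by blast
      finally show ?thesis .
    qed
  qed
  then show ?thesis unfolding graph_iso_def using bij by blast
qed


text \<open>Every off-diagonal entry contributes at least 1, with equality exactly at edges;
  \<open>e\<close> is the excess over that minimum.\<close>

lemma (in conn_graph) complete_iff_sum_dist_squares:
  "(\<forall>u<n. \<forall>v<n. u \<noteq> v \<longrightarrow> E u v) \<longleftrightarrow> (\<Sum>i<n. \<Sum>j<n. (real (d i j))\<^sup>2) = (real n)\<^sup>2 - real n"
proof -
  define e where "e i j = (real (d i j))\<^sup>2 - (if j = i then 0 else 1)" for i j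
  have e: "0 \<le> e i j" "e i j = 0 \<longleftrightarrow> i = j \<or> E i j" if ij: "i < n" "j < n" for i j
  proof -
    consider "i = j" | "i \<noteq> j" "E i j" | "i \<noteq> j" "\<not> E i j" by blast
    then have "0 \<le> e i j \<and> (e i j = 0 \<longleftrightarrow> i = j \<or> E i j)"
    proof cases
      case 3
      then have "2 \<le> real (d i j)" using dist_ge_2 ij by fastforce
      then have "2\<^sup>2 \<le> (real (d i j))\<^sup>2" by (intro power_mono) auto
      then show ?thesis using 3 by (simp add: e_def)
    qed (use ij dist_adj in \<open>auto simp: e_def\<close>)
    then show "0 \<le> e i j" "e i j = 0 \<longleftrightarrow> i = j \<or> E i j" by auto
  qed
  have "(\<Sum>j<n. if j = i then 0 else 1) = real n - 1" if "i < n" for i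
    using sum_if_eq[of "{..<n}" i 0 1] that by simp
  then have "(\<Sum>i<n. \<Sum>j<n. if j = i then 0 else (1::real)) = real n * (real n - 1)" by simp
  moreover have "(\<Sum>i<n. \<Sum>j<n. e i j) = (\<Sum>i<n. \<Sum>j<n. (real (d i j))\<^sup>2) - (\<Sum>i<n. \<Sum>j<n. if j = i then 0 else 1)"
    by (simp only: e_def sum_subtractf)
  ultimately have s: "(\<Sum>i<n. \<Sum>j<n. (real (d i j))\<^sup>2) = (real n)\<^sup>2 - real n + (\<Sum>i<n. \<Sum>j<n. e i j)"
    by (simp add: power2_eq_square algebra_simps)
  have "(\<Sum>i<n. \<Sum>j<n. e i j) = 0 \<longleftrightarrow> (\<forall>i<n. (\<Sum>j<n. e i j) = 0)"
    using e(1) by (subst sum_nonneg_eq_0_iff) (auto intro!: sum_nonneg)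
  also have "\<dots> \<longleftrightarrow> (\<forall>i<n. \<forall>j<n. e i j = 0)"
  proof (intro all_cong)
    fix i assume "i < n"
    then show "(\<Sum>j<n. e i j) = 0 \<longleftrightarrow> (\<forall>j<n. e i j = 0)"
      using sum_nonneg_eq_0_iff[of "{..<n}" "e i"] e(1) by auto
  qed
  also have "\<dots> \<longleftrightarrow> (\<forall>u<n. \<forall>v<n. u \<noteq> v \<longrightarrow> E u v)" using e(2) by blast
  finally show ?thesis using s by auto
qed

lemma complete_graphs_iso:
  assumes "connected_graph n E" "connected_graph n F"
    "\<forall>u<n. \<forall>v<n. u \<noteq> v \<longrightarrow> E u v" "\<forall>u<n. \<forall>v<n. u \<noteq> v \<longrightarrow> F u v"
  shows "graph_iso n E n F"
proof -
  have "E u v \<longleftrightarrow> F u v" if "u < n" "v < n" for u v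
    using conn_graph.adj_irrefl[OF conn_graph.intro[OF assms(1)]]
      conn_graph.adj_irrefl[OF conn_graph.intro[OF assms(2)]] assms(3,4) that by metis
  then show ?thesis unfolding graph_iso_def by (intro exI[of _ id]) auto
qed

lemma pendant_graph_not_cospectral_windmill:
  assumes G: "pendant_graph n E K" and H: "windmill_graph n F z"
    and chi: "char_poly (dist_matrix n E) = char_poly (dist_matrix n F)"
    and sq: "(\<Sum>i<n. \<Sum>j<n. (real (gdist n E i j))\<^sup>2) = (\<Sum>i<n. \<Sum>j<n. (real (gdist n F i j))\<^sup>2)"
  shows False
proof -
  interpret G: pendant_graph n E K by (rule G)
  interpret H: windmill_graph n F z by (rule H)
  have s: "sqrt 2 * sqrt 2 = (2::real)" by simp
  have "(- 2 + sqrt 2)\<^sup>2 + 4 * (- 2 + sqrt 2) + 2 = (0::real)"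
    "(- 2 - sqrt 2)\<^sup>2 + 4 * (- 2 - sqrt 2) + 2 = (0::real)"
    using s by (simp_all add: power2_eq_square algebra_simps)
  then have roots: "poly (char_poly (dist_matrix n F)) (- 2 + sqrt 2) = 0"
    "poly (char_poly (dist_matrix n F)) (- 2 - sqrt 2) = 0"
    using G.pendant_eigenvalue unfolding chi by blast+
  define t where "t = card G.L"
  have n: "n = 11" using H.windmill_conjugate_roots(1)[OF roots] .
  have "(real n)\<^sup>2 - real n + 6 * real n * real t + 2 * (real t)\<^sup>2 - 14 * real t = 332"
    using H.windmill_conjugate_roots(2)[OF roots] G.sum_dist_squares_pendant sq unfolding t_def by simp
  \<comment> \<open>The left side is 87 at t = 3 and 120 at t = 4, so no natural number t satisfies
    this.\<close>
  then have "real (t * t + 26 * t) = real 111" unfolding n by (simp add: power2_eq_square)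
  then have t: "t * t + 26 * t = 111" by (simp only: of_nat_eq_iff)
  show False
  proof (cases "t \<le> 3")
    case True
    then have "t * t \<le> 3 * 3" by (intro mult_le_mono) auto
    then show False using t True by linarith
  next
    case False
    then have "4 * 4 \<le> t * t" by (intro mult_le_mono) auto
    then show False using t False by linarith
  qed
qed

text \<open>The difference of the two sums factors as t - t' times 6 n + 2 (t + t') - 14, and the
  latter is positive because n, t and t' are at least 2.\<close>

lemma pendant_graphs_same_card:
  assumes G: "pendant_graph n E K" and H: "pendant_graph n F K'"
    and sq: "(\<Sum>i<n. \<Sum>j<n. (real (gdist n E i j))\<^sup>2) = (\<Sum>i<n. \<Sum>j<n. (real (gdist n F i j))\<^sup>2)"
  shows "card ({..<n} - K) = card ({..<n} - K')"
proof -
  interpret G: pendant_graph n E K by (rule G)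
  interpret H: pendant_graph n F K' by (rule H)
  define t t' where "t = real (card G.L)" and "t' = real (card H.L)"
  have t: "2 \<le> t" "2 \<le> t'" using G.two_pendants H.two_pendants by (simp_all add: t_def t'_def)
  have "card G.L \<le> n" using card_mono[of "{..<n}" G.L] by auto
  then have n: "t \<le> real n" by (simp add: t_def)
  have "6 * real n * t + 2 * t\<^sup>2 - 14 * t = 6 * real n * t' + 2 * t'\<^sup>2 - 14 * t'"
    using sq unfolding G.sum_dist_squares_pendant H.sum_dist_squares_pendant t_def t'_def by simp
  then have "(t - t') * (6 * real n + 2 * (t + t') - 14) = 0"
    by (simp add: power2_eq_square algebra_simps)
  moreover have "0 < 6 * real n + 2 * (t + t') - 14" using t n by argo
  ultimately have "t = t'" by simp
  then show ?thesis by (simp add: t_def t'_def)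
qed

theorem theorem3p7:
  fixes n :: nat and E :: "nat \<Rightarrow> nat \<Rightarrow> bool"
  assumes "connected_graph n E"
    and "2 \<le> n"
    and "D_eig n E 2 \<le> (17 - sqrt 329) / 2"
  shows "\<forall>m F. connected_graph m F \<and> D_spectrum m F = D_spectrum n E \<longrightarrow> graph_iso n E m F"
proof (intro allI impI)
  fix m F assume "connected_graph m F \<and> D_spectrum m F = D_spectrum n E"
  then have F: "connected_graph m F" and spec: "D_spectrum m F = D_spectrum n E" by auto
  interpret G: small_second n E using assms by unfold_locales
  interpret HF: conn_graph m F using F by unfold_locales
  have m: "m = n" using G.spectrum_char_poly(2) HF.spectrum_char_poly(2) spec by simp
  have chi: "char_poly (dist_matrix n E) = char_poly (dist_matrix n F)"
    using G.spectrum_char_poly(1) HF.spectrum_char_poly(1) spec m by simp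
  have sq: "(\<Sum>i<n. \<Sum>j<n. (real (G.d i j))\<^sup>2) = (\<Sum>i<n. \<Sum>j<n. (real (gdist n F i j))\<^sup>2)"
    using G.spectrum_char_poly(3) HF.spectrum_char_poly(3) spec m by simp
  have Fn: "connected_graph n F" using F m by simp
  interpret H: small_second n F
    using Fn assms(2,3) spec m by unfold_locales (auto simp: D_eig_def)
  have "graph_iso n E n F"
  proof (cases "\<forall>u<n. \<forall>v<n. u \<noteq> v \<longrightarrow> E u v")
    case True
    then have "\<forall>u<n. \<forall>v<n. u \<noteq> v \<longrightarrow> F u v"
      using G.complete_iff_sum_dist_squares H.complete_iff_sum_dist_squares sq by simp
    then show ?thesis using complete_graphs_iso[OF assms(1) Fn True] by blast
  next
    case nE: False
    then have nF: "\<not> (\<forall>u<n. \<forall>v<n. u \<noteq> v \<longrightarrow> F u v)"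
      using G.complete_iff_sum_dist_squares H.complete_iff_sum_dist_squares sq by simp
    consider (w) z a b where "windmill n E z" "a < n" "b < n" "a \<noteq> b" "\<not> E a b"
      | (p) K where "clique_with_pendants n E K"
      using G.classification nE by metis
    then show ?thesis
    proof cases
      case w
      then interpret GW: windmill_graph n E z by unfold_locales
      consider (w') z' a' b' where "windmill n F z'" "a' < n" "b' < n" "a' \<noteq> b'" "\<not> F a' b'"
        | (p') K' where "clique_with_pendants n F K'"
        using H.classification nF by metis
      then show ?thesis
      proof cases
        case w'
        then interpret HW: windmill_graph n F z' by unfold_locales
        show ?thesis
          using windmills_iso[OF GW.windmill_graph_axioms HW.windmill_graph_axioms
              GW.two_blades[OF w(2-5)] HW.two_blades[OF w'(2-5)] chi] .
      next
        case p'
        then interpret HP: pendant_graph n F K' by unfold_locales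
        show ?thesis
          using pendant_graph_not_cospectral_windmill[OF HP.pendant_graph_axioms GW.windmill_graph_axioms
              chi[symmetric] sq[symmetric]] by blast
      qed
    next
      case p
      then interpret GP: pendant_graph n E K by unfold_locales
      consider (w') z' where "windmill n F z'" | (p') K' where "clique_with_pendants n F K'"
        using H.classification nF by metis
      then show ?thesis
      proof cases
        case w'
        then interpret HW: windmill_graph n F z' by unfold_locales
        show ?thesis
          using pendant_graph_not_cospectral_windmill[OF GP.pendant_graph_axioms HW.windmill_graph_axioms chi sq]
          by blast
      next
        case p'
        then interpret HP: pendant_graph n F K' by unfold_locales
        show ?thesis
          using pendant_graphs_iso[OF GP.pendant_graph_axioms HP.pendant_graph_axioms
              pendant_graphs_same_card[OF GP.pendant_graph_axioms HP.pendant_graph_axioms sq]] .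
      qed
    qed
  qed
  then show "graph_iso n E m F" using m by simp
qed

end
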